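(* Let $B>0$ and let $\phi\in L^2(\mathbb{R})$ be a real-valued window such that $(\mathcal{F}\phi)(\xi)\neq 0$ for almost every $\xi\in(-B,B)$. Then for all $f,g\in\mathrm{PW}^2_B$ that are real-valued on the real line, the following are equivalent: (1) $f=\pm g$; (2) $\left|\mathcal{V}_\phi f\left(\tfrac{n}{4B},0\right)\right|=\left|\mathcal{V}_\phi g\left(\tfrac{n}{4B},0\right)\right|$ for all $n\in\mathbb{Z}$.
   Context: The Fourier transform is $\mathcal{F}f(\xi)=\int_{\mathbb{R}}f(t)e^{-2\pi i t\xi}\,dt$ on $L^1(\mathbb{R})$, extended to $L^2(\mathbb{R})$ by density. For $B>0$, the Paley--Wiener space is $\mathrm{PW}^2_B:=\{f:\mathbb{C}\to\mathbb{C} \mid \exists F\in L^2([-B,B])\ \forall z\in\mathbb{C}: f(z)=\int_{-B}^B F(\xi)e^{2\pi i \xi z}\,d\xi\}$; its elements are identified with their restrictions to $\mathbb{R}$ (which lie in $L^2(\mathbb{R})$) when transforms are applied. For $f,\phi\in L^2(\mathbb{R})$ the short-time Fourier transform is $\mathcal{V}_\phi f(x,\omega)=\int_{\mathbb{R}} f(t)\overline{\phi(t-x)}e^{-2\pi i t\omega}\,dt$, $x,\omega\in\mathbb{R}$. *)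

theory Defs
  imports "HOL-Analysis.Analysis"
begin

definition square_integrable :: "(real \<Rightarrow> complex) \<Rightarrow> bool" where
  "square_integrable h \<longleftrightarrow>
     h \<in> borel_measurable lborel \<and> integrable lborel (\<lambda>t. (cmod (h t))\<^sup>2)"

definition L2_dist_sq :: "(real \<Rightarrow> complex) \<Rightarrow> (real \<Rightarrow> complex) \<Rightarrow> ennreal" where
  "L2_dist_sq h G = (\<integral>\<^sup>+ \<xi>. ennreal ((cmod (h \<xi> - G \<xi>))\<^sup>2) \<partial>lborel)"

definition fourier_L1 :: "(real \<Rightarrow> complex) \<Rightarrow> real \<Rightarrow> complex" where
  "fourier_L1 h \<xi> = (LINT t|lborel. h t * exp (- (2 * of_real pi * \<i> * of_real t * of_real \<xi>)))"

text \<open>G is (a representative of) the Fourier transform of phi in L2, i.e. the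
  extension by density: for every sequence of L1 \<inter> L2 functions converging to
  phi in L2, their L1 Fourier transforms converge to G in L2.\<close>
definition is_fourier_L2 :: "(real \<Rightarrow> complex) \<Rightarrow> (real \<Rightarrow> complex) \<Rightarrow> bool" where
  "is_fourier_L2 \<phi> G \<longleftrightarrow>
     G \<in> borel_measurable lborel \<and>
     (\<forall>h :: nat \<Rightarrow> real \<Rightarrow> complex.
        (\<forall>n. integrable lborel (h n) \<and> square_integrable (h n)) \<and>
        ((\<lambda>n. L2_dist_sq (h n) \<phi>) \<longlonglongrightarrow> 0)
        \<longrightarrow> ((\<lambda>n. L2_dist_sq (fourier_L1 (h n)) G) \<longlonglongrightarrow> 0))"

definition PW :: "real \<Rightarrow> (complex \<Rightarrow> complex) set" where
  "PW B = {f. \<exists>F :: real \<Rightarrow> complex.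
      set_borel_measurable lborel {-B..B} F \<and>
      set_integrable lborel {-B..B} (\<lambda>\<xi>. (cmod (F \<xi>))\<^sup>2) \<and>
      (\<forall>z. f z = (LINT \<xi>:{-B..B}|lborel. F \<xi> * exp (2 * of_real pi * \<i> * of_real \<xi> * z)))}"

definition stft :: "(real \<Rightarrow> complex) \<Rightarrow> (real \<Rightarrow> complex) \<Rightarrow> real \<Rightarrow> real \<Rightarrow> complex" where
  "stft \<phi> f x \<omega> = (LINT t|lborel. f t * cnj (\<phi> (t - x)) * exp (- (2 * of_real pi * \<i> * of_real t * of_real \<omega>)))"

end

theory Submission
  imports Defs "HOL-Complex_Analysis.Complex_Analysis"
begin

text \<open>
  Write \<open>f\<close> as the Fourier integral of \<open>F\<close> supported in \<open>(-B, B)\<close>. By Parseval, \<open>x \<mapsto> stft \<phi> f x 0\<close> is the Fourier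
  integral of \<open>F * cnj G\<close>, where \<open>G\<close> is the transform of \<open>\<phi>\<close>; for real \<open>f\<close> and \<open>\<phi>\<close> it is real. Hence the samples
  agree in modulus iff the product of the transforms of \<open>f - g\<close> and \<open>f + g\<close> vanishes on \<open>\<int> / (4B)\<close>. This product is
  a Fourier integral of a function of bandwidth \<open>2B\<close>, and its samples are the Fourier coefficients on \<open>(-2B, 2B)\<close>,
  so it vanishes on the whole real line. Both factors are entire, so one of them is zero, and since \<open>G \<noteq> 0\<close> almost
  everywhere on the band, uniqueness of the Fourier transform gives \<open>f = g\<close> or \<open>f = -g\<close>.

  Plancherel is not needed for Parseval: since the definition of \<open>G\<close> allows arbitrary approximating sequences, the integral of
  \<open>f (t + x) * \<phi> t\<close> over \<open>A\<^sub>n\<close> converges for all bounded sets \<open>A\<^sub>n \<supseteq> [-n, n]\<close>, which already forces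
  integrability.
\<close>

section \<open>Vanishing Fourier coefficients\<close>

text \<open>On the circle a real-linear functional is a combination of \<open>cis u\<close> and
  \<open>cis (- u)\<close>, and Laurent polynomials in \<open>cis u\<close> are closed under sums
  and products. The factor \<open>cis (- (real N * u))\<close> carries the negative powers, so that
  \<open>P\<close> can be an ordinary polynomial.\<close>

lemma real_polynomial_function_cis:
  fixes p :: "complex \<Rightarrow> real"
  assumes "real_polynomial_function p"
  shows "\<exists>N P. \<forall>u. complex_of_real (p (cis u)) = cis (- (real N * u)) * poly P (cis u)"
  using assms
proof (induction p rule: real_polynomial_function.induct)
  case (linear h)
  interpret h: bounded_linear h by fact
  \<comment> \<open>With \<open>a = Complex (h 1) (h \<i>)\<close>, the value
    \<open>h (cis u)\<close> is the real part of \<open>a * cis (- u)\<close>, hence half the sum of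
    this number and its conjugate. Clearing the negative power gives these coefficients.\<close>
  define P where "P = [: Complex (h 1) (h \<i>) / 2, 0, Complex (h 1) (- h \<i>) / 2 :]"
  have "complex_of_real (h (cis u)) = cis (- (real 1 * u)) * poly P (cis u)" for u
  proof -
    have "h (cis u) = h (cos u *\<^sub>R 1 + sin u *\<^sub>R \<i>)"
      by (rule arg_cong[where f = h]) (simp add: complex_eq_iff)
    also have "\<dots> = cos u * h 1 + sin u * h \<i>"
      by (simp only: h.add h.scale real_scaleR_def)
    finally have *: "h (cis u) = cos u * h 1 + sin u * h \<i>" .
    have "cis (- u) * poly P (cis u)
        = Complex (h 1) (h \<i>) / 2 * cis (- u) + Complex (h 1) (- h \<i>) / 2 * (cis (- u) * (cis u * cis u))"
      by (simp add: P_def algebra_simps)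
    also have "cis (- u) * (cis u * cis u) = cis u"
      by (simp add: cis_mult)
    also have "Complex (h 1) (h \<i>) / 2 * cis (- u) + Complex (h 1) (- h \<i>) / 2 * cis u
        = complex_of_real (cos u * h 1 + sin u * h \<i>)"
      by (simp add: complex_eq_iff field_simps)
    finally show ?thesis
      unfolding * by simp
  qed
  then show ?case by blast
next
  case (const c)
  have "complex_of_real c = cis (- (real 0 * u)) * poly [: of_real c :] (cis u)" for u by simp
  then show ?case by blast
next
  case (add f g)
  then obtain N P N' P' where
    "\<And>u. complex_of_real (f (cis u)) = cis (- (real N * u)) * poly P (cis u)"
    "\<And>u. complex_of_real (g (cis u)) = cis (- (real N' * u)) * poly P' (cis u)" by blast
  \<comment> \<open>Both summands are brought to the common denominator
    \<open>cis u ^ (N + N')\<close>.\<close>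
  moreover have "cis (- (real (N + N') * u)) * cis u ^ N' = cis (- (real N * u))"
    "cis (- (real (N + N') * u)) * cis u ^ N = cis (- (real N' * u))" for u
    unfolding Complex.DeMoivre cis_mult by (rule arg_cong[where f = cis], simp add: algebra_simps)+
  ultimately have "complex_of_real (f (cis u) + g (cis u))
     = cis (- (real (N + N') * u)) * poly (P * monom 1 N' + P' * monom 1 N) (cis u)" for u
    by (simp add: poly_monom distrib_left flip: mult.assoc) (simp add: mult_ac)
  then show ?case by blast
next
  case (mult f g)
  then obtain N P N' P' where
    "\<And>u. complex_of_real (f (cis u)) = cis (- (real N * u)) * poly P (cis u)"
    "\<And>u. complex_of_real (g (cis u)) = cis (- (real N' * u)) * poly P' (cis u)" by blast
  moreover have "cis (- (real (N + N') * u)) = cis (- (real N * u)) * cis (- (real N' * u))" for u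
    by (simp add: cis_mult algebra_simps)
  ultimately have "complex_of_real (f (cis u) * g (cis u))
     = cis (- (real (N + N') * u)) * poly (P * P') (cis u)" for u
    by (simp only: of_real_mult poly_mult mult_ac)
  then show ?case by blast
qed

lemma borel_measurable_circle:
  fixes \<Psi> :: "complex \<Rightarrow> real"
  assumes "continuous_on (sphere 0 1) \<Psi>"
  shows "(\<lambda>x. \<Psi> (cis x)) \<in> borel_measurable borel"
  by (intro borel_measurable_continuous_onI continuous_on_compose2[OF assms] continuous_intros) auto

text \<open>By Stone-Weierstrass, \<open>\<Psi>\<close> is uniformly close on the circle to a
  polynomial. Integrals against polynomials vanish, since these are Laurent polynomials in
  \<open>cis (u w)\<close>, and a uniform error \<open>e\<close> changes the integral by at most
  \<open>e\<close> times the L1 norm of \<open>K\<close>.\<close>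

lemma integral_eq_0_circle:
  fixes K :: "'a \<Rightarrow> complex" and u :: "'a \<Rightarrow> real" and \<Psi> :: "complex \<Rightarrow> real"
  assumes K [measurable]: "integrable M K" and u [measurable]: "u \<in> borel_measurable M"
    and zero: "\<And>n::int. (LINT w|M. K w * cis (of_int n * u w)) = 0"
    and \<Psi>: "continuous_on (sphere 0 1) \<Psi>"
  shows "(LINT w|M. K w * of_real (\<Psi> (cis (u w)))) = 0"
proof -
  have cis_borel [measurable]: "cis \<in> borel_measurable borel"
    by (intro borel_measurable_continuous_onI continuous_intros)
  have [measurable]: "K \<in> borel_measurable M" using K by simp
  note borel_measurable_circle[OF \<Psi>, measurable]
  have int_cis: "integrable M (\<lambda>w. K w * cis (s * u w))" for s
    by (rule Bochner_Integration.integrable_bound[OF K]) (auto simp: norm_mult)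
  have poly0: "integrable M (\<lambda>w. K w * of_real (p (cis (u w))))"
    "(LINT w|M. K w * of_real (p (cis (u w)))) = 0"
    if p: "real_polynomial_function p" for p
  proof -
    obtain N P where NP: "\<And>u. complex_of_real (p (cis u)) = cis (- (real N * u)) * poly P (cis u)"
      using real_polynomial_function_cis[OF p] by blast
    have eq: "K w * of_real (p (cis (u w)))
        = (\<Sum>i\<le>degree P. coeff P i * (K w * cis (of_int (int i - int N) * u w)))" for w
    proof -
      have "cis (- (real N * u w)) * cis (u w) ^ i = cis (of_int (int i - int N) * u w)" for i
        unfolding Complex.DeMoivre cis_mult by (rule arg_cong[where f = cis]) (simp add: algebra_simps)
      then show ?thesis
        by (simp add: NP poly_altdef sum_distrib_left algebra_simps)
    qed
    show "integrable M (\<lambda>w. K w * of_real (p (cis (u w))))"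
      unfolding eq by (intro Bochner_Integration.integrable_sum integrable_mult_right int_cis)
    show "(LINT w|M. K w * of_real (p (cis (u w)))) = 0"
      unfolding eq
      by (subst Bochner_Integration.integral_sum) (auto intro!: integrable_mult_right int_cis simp del: of_int_diff simp: zero)
  qed
  have bound: "norm (LINT w|M. K w * of_real (\<Psi> (cis (u w)))) \<le> e * (LINT w|M. norm (K w))" if e: "e > 0" for e
  proof -
    obtain p where p: "real_polynomial_function p" "\<And>z. z \<in> sphere 0 1 \<Longrightarrow> \<bar>\<Psi> z - p z\<bar> < e"
      using Stone_Weierstrass_real_polynomial_function[OF compact_sphere \<Psi> e] by metis
    have bd: "\<bar>\<Psi> (cis (u w)) - p (cis (u w))\<bar> \<le> e" for w
      using p(2)[of "cis (u w)"] by simp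
    have [measurable]: "p \<in> borel_measurable borel"
      using p(1) by (intro borel_measurable_continuous_onI) (auto intro: continuous_on_polymonial_function simp: real_polynomial_function_eq)
    have nb: "norm (K w * of_real (\<Psi> (cis (u w)) - p (cis (u w)))) \<le> e * norm (K w)" for w
      unfolding norm_mult norm_of_real using mult_left_mono[OF bd, of "norm (K w)"] by (simp add: mult.commute)
    have int: "integrable M (\<lambda>w. K w * of_real (\<Psi> (cis (u w)) - p (cis (u w))))"
    proof (rule Bochner_Integration.integrable_bound[of M "\<lambda>w. e * norm (K w)"])
      show "AE w in M. norm (K w * of_real (\<Psi> (cis (u w)) - p (cis (u w)))) \<le> norm (e * norm (K w))"
        using nb e by simp
    qed (use K in auto)
    have "(LINT w|M. K w * of_real (\<Psi> (cis (u w))))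
        = (LINT w|M. K w * of_real (\<Psi> (cis (u w)) - p (cis (u w))) + K w * of_real (p (cis (u w))))"
      by (intro Bochner_Integration.integral_cong refl) (simp add: algebra_simps)
    also have "\<dots> = (LINT w|M. K w * of_real (\<Psi> (cis (u w)) - p (cis (u w))))"
      using int poly0[OF p(1)] by simp
    finally have "norm (LINT w|M. K w * of_real (\<Psi> (cis (u w))))
        \<le> (LINT w|M. norm (K w * of_real (\<Psi> (cis (u w)) - p (cis (u w)))))"
      by simp
    also have "\<dots> \<le> (LINT w|M. e * norm (K w))"
      by (intro integral_mono integrable_norm int nb integrable_mult_right) (use K in auto)
    finally show ?thesis by simp
  qed
  show ?thesis
  proof (rule ccontr)
    define c where "c = norm (LINT w|M. K w * of_real (\<Psi> (cis (u w))))"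
    define d where "d = (LINT w|M. norm (K w))"
    assume "(LINT w|M. K w * of_real (\<Psi> (cis (u w)))) \<noteq> 0"
    then have "c > 0" by (simp add: c_def)
    moreover have "d \<ge> 0" by (simp add: d_def)
    \<comment> \<open>The error \<open>e = c / (2 * (d + 1))\<close> makes the bound smaller than
      \<open>c\<close>; the summand 1 keeps the denominator positive when
      \<open>d = 0\<close>.\<close>
    ultimately have "c \<le> c / (2 * (d + 1)) * d"
      using bound[of "c / (2 * (d + 1))"] by (simp flip: c_def d_def)
    moreover have "c / (2 * (d + 1)) * d < c"
      using \<open>c > 0\<close> \<open>d \<ge> 0\<close> by (simp add: field_simps add_nonneg_pos)
    ultimately show False by simp
  qed
qed

text \<open>The function \<open>\<psi> \<circ> Arg\<close> is discontinuous on the circle at \<open>-1\<close>. It is multiplied by the continuous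
  cutoff \<open>1 - ((1 - Re z) / 2) ^ m\<close>, which vanishes at \<open>-1\<close> and tends to \<open>1\<close> elsewhere on the circle.\<close>

lemma integral_eq_0_interval:
  fixes K :: "'a \<Rightarrow> complex" and u :: "'a \<Rightarrow> real" and \<psi> :: "real \<Rightarrow> real"
  assumes K: "integrable M K" and u [measurable]: "u \<in> borel_measurable M"
    and supp: "\<And>w. K w \<noteq> 0 \<Longrightarrow> \<bar>u w\<bar> < pi"
    and zero: "\<And>n::int. (LINT w|M. K w * cis (of_int n * u w)) = 0"
    and \<psi>: "continuous_on UNIV \<psi>" and bdd: "\<And>x. \<bar>\<psi> x\<bar> \<le> C"
  shows "(LINT w|M. K w * of_real (\<psi> (u w))) = 0"
proof -
  have [measurable]: "K \<in> borel_measurable M" using K by simp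
  have [measurable]: "\<psi> \<in> borel_measurable borel"
    by (intro borel_measurable_continuous_onI \<psi>)
  define \<eta> :: "nat \<Rightarrow> complex \<Rightarrow> real" where "\<eta> m z = 1 - ((1 - Re z) / 2) ^ m" for m z
  have cont: "continuous_on (sphere 0 1) (\<lambda>z. \<eta> m z * \<psi> (Arg z))" if "m > 0" for m
  unfolding continuous_on_eq_continuous_within
  proof
    fix z :: complex assume z: "z \<in> sphere 0 1"
    have \<eta>_cont: "isCont (\<eta> m) z" unfolding \<eta>_def by (intro continuous_intros) auto
    show "continuous (at z within sphere 0 1) (\<lambda>z. \<eta> m z * \<psi> (Arg z))"
    proof (cases "z = -1")
      case False
      have "z \<notin> \<real>\<^sub>\<le>\<^sub>0"
      proof
        assume "z \<in> \<real>\<^sub>\<le>\<^sub>0"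
        then obtain r where "z = of_real r" "r \<le> 0" by (auto elim: nonpos_Reals_cases)
        with z False show False by auto
      qed
      then have "isCont Arg z" by (rule continuous_at_Arg)
      moreover have "isCont \<psi> (Arg z)" using \<psi> by (simp add: continuous_on_eq_continuous_at)
      ultimately have "isCont (\<lambda>z. \<psi> (Arg z)) z" by (rule isCont_o2)
      with \<eta>_cont have "isCont (\<lambda>z. \<eta> m z * \<psi> (Arg z)) z" by (rule continuous_mult)
      then show ?thesis by (rule continuous_at_imp_continuous_at_within)
    next
      case True
      have "\<eta> m z = 0" using True \<open>m > 0\<close> by (simp add: \<eta>_def)
      with \<eta>_cont have lim: "(\<eta> m \<longlongrightarrow> 0) (at z)" by (simp add: isCont_def)
      \<comment> \<open>\<open>Arg\<close> jumps here, but \<open>\<psi>\<close> is bounded and the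
        cutoff tends to 0, so the product is continuous with value 0.\<close>
      have "((\<lambda>z. \<eta> m z * \<psi> (Arg z)) \<longlongrightarrow> 0) (at z)"
      proof (rule Lim_null_comparison)
        show "\<forall>\<^sub>F w in at z. norm (\<eta> m w * \<psi> (Arg w)) \<le> \<bar>\<eta> m w\<bar> * C"
          by (intro always_eventually allI) (simp add: abs_mult mult_left_mono bdd)
        show "((\<lambda>w. \<bar>\<eta> m w\<bar> * C) \<longlongrightarrow> 0) (at z)"
          using tendsto_mult_left_zero[OF tendsto_rabs_zero[OF lim]] .
      qed
      then have "isCont (\<lambda>z. \<eta> m z * \<psi> (Arg z)) z"
        unfolding isCont_def using \<open>\<eta> m z = 0\<close> by simp
      then show ?thesis by (rule continuous_at_imp_continuous_at_within)
    qed
  qed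
  have meas [measurable]: "(\<lambda>x. \<eta> (Suc m) (cis x) * \<psi> (Arg (cis x))) \<in> borel_measurable borel" for m
    by (rule borel_measurable_circle[OF cont]) simp
  have zero_m: "(LINT w|M. K w * of_real (\<eta> (Suc m) (cis (u w)) * \<psi> (Arg (cis (u w))))) = 0" for m
    by (rule integral_eq_0_circle[OF K u zero cont]) simp
  have "(\<lambda>m. LINT w|M. K w * of_real (\<eta> (Suc m) (cis (u w)) * \<psi> (Arg (cis (u w)))))
      \<longlonglongrightarrow> (LINT w|M. K w * of_real (\<psi> (u w)))"
  proof (rule integral_dominated_convergence[where w = "\<lambda>w. norm (K w) * C"])
    have Re_bd: "\<bar>(1 - cos x) / 2\<bar> \<le> 1" for x :: real
      using cos_ge_minus_one[of x] cos_le_one[of x] by (simp add: abs_le_iff)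
    have \<eta>_bd: "\<bar>\<eta> m (cis x)\<bar> \<le> 1" for m x
    proof -
      have "0 \<le> (1 - cos x) / 2" by simp
      then have "0 \<le> ((1 - cos x) / 2) ^ m" "((1 - cos x) / 2) ^ m \<le> 1"
        using Re_bd[of x] by (auto intro!: power_le_one zero_le_power simp: abs_le_iff simp del: zero_le_power)
      then show ?thesis by (simp add: \<eta>_def)
    qed
    show "AE w in M. norm (K w * of_real (\<eta> (Suc m) (cis (u w)) * \<psi> (Arg (cis (u w))))) \<le> norm (K w) * C" for m
    proof (intro AE_I2)
      fix w
      have "\<bar>\<eta> (Suc m) (cis (u w)) * \<psi> (Arg (cis (u w)))\<bar> \<le> 1 * C"
        unfolding abs_mult by (intro mult_mono \<eta>_bd bdd) auto
      then show "norm (K w * of_real (\<eta> (Suc m) (cis (u w)) * \<psi> (Arg (cis (u w))))) \<le> norm (K w) * C"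
        unfolding norm_mult norm_of_real by (intro mult_left_mono) auto
    qed
    show "AE w in M. (\<lambda>m. K w * of_real (\<eta> (Suc m) (cis (u w)) * \<psi> (Arg (cis (u w))))) \<longlonglongrightarrow> K w * of_real (\<psi> (u w))"
    proof (intro AE_I2)
      fix w
      show "(\<lambda>m. K w * of_real (\<eta> (Suc m) (cis (u w)) * \<psi> (Arg (cis (u w))))) \<longlonglongrightarrow> K w * of_real (\<psi> (u w))"
      proof (cases "K w = 0")
        case False
        \<comment> \<open>The strict bound keeps \<open>cis (u w)\<close> away from -1. Hence
          \<open>Arg\<close> recovers \<open>u w\<close>, and the base
          \<open>(1 - cos (u w)) / 2\<close> of the power is below 1, so the cutoff tends to
          1.\<close>
        then have "\<bar>u w\<bar> < pi" by (rule supp)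
        then have Arg: "Arg (cis (u w)) = u w" by (intro Arg_cis) auto
        have "cos (u w) > -1"
        proof -
          have "cos pi < cos \<bar>u w\<bar>"
            using \<open>\<bar>u w\<bar> < pi\<close> by (intro cos_monotone_0_pi) auto
          then show ?thesis by simp
        qed
        then have "(\<lambda>m. ((1 - cos (u w)) / 2) ^ Suc m) \<longlonglongrightarrow> 0"
          by (intro LIMSEQ_Suc LIMSEQ_power_zero) (use cos_le_one[of "u w"] in \<open>simp add: field_simps\<close>)
        then have "(\<lambda>m. \<eta> (Suc m) (cis (u w))) \<longlonglongrightarrow> 1 - 0"
          unfolding \<eta>_def cis.sel by (intro tendsto_intros)
        then have "(\<lambda>m. \<eta> (Suc m) (cis (u w))) \<longlonglongrightarrow> 1" by simp
        then have "(\<lambda>m. K w * of_real (\<eta> (Suc m) (cis (u w)) * \<psi> (u w))) \<longlonglongrightarrow> K w * of_real (1 * \<psi> (u w))"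
          by (intro tendsto_intros)
        then show ?thesis by (simp only: Arg mult_1_left)
      qed simp
    qed
    show "integrable M (\<lambda>w. norm (K w) * C)" using K by simp
  qed measurable
  moreover have "(\<lambda>m. LINT w|M. K w * of_real (\<eta> (Suc m) (cis (u w)) * \<psi> (Arg (cis (u w))))) = (\<lambda>m. 0)"
    by (rule ext) (rule zero_m)
  ultimately show ?thesis
    using LIMSEQ_unique by (metis tendsto_const)
qed

section \<open>Fourier integrals of compactly supported functions\<close>

text \<open>Indicators of half-lines are pointwise limits of bounded continuous functions, so
  \<open>H\<close> integrates to 0 over half-lines. These form an intersection-stable generator of
  the Borel sets; hence all set integrals of \<open>H\<close> vanish, and so does the density
  \<open>H\<close>.\<close>

lemma AE_eq_0_if_integral_continuous_0:
  fixes H :: "real \<Rightarrow> complex"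
  assumes H: "integrable lborel H"
    and zero: "\<And>\<psi>::real \<Rightarrow> real. continuous_on UNIV \<psi> \<Longrightarrow> (\<And>x. \<bar>\<psi> x\<bar> \<le> 1) \<Longrightarrow>
        (LINT \<xi>|lborel. H \<xi> * of_real (\<psi> \<xi>)) = 0"
  shows "AE \<xi> in lborel. H \<xi> = 0"
proof (rule sigma_finite_measure.density_zero[OF lborel.sigma_finite_measure_axioms H])
  have [measurable]: "H \<in> borel_measurable borel" using H by simp
  have half_line: "set_lebesgue_integral lborel {..a} H = 0" for a
  proof -
    \<comment> \<open>For \<open>k > 0\<close> this is 1 up to \<open>a\<close> and falls linearly
      to 0 on \<open>[a, a + 1/k]\<close>.\<close>
    define \<psi> :: "nat \<Rightarrow> real \<Rightarrow> real" where "\<psi> k \<xi> = max 0 (1 - real k * max 0 (\<xi> - a))" for k \<xi>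
    have "(\<lambda>k. LINT \<xi>|lborel. H \<xi> * of_real (\<psi> k \<xi>)) \<longlonglongrightarrow> (LINT \<xi>|lborel. indicator {..a} \<xi> *\<^sub>R H \<xi>)"
    proof (rule integral_dominated_convergence[where w = "\<lambda>\<xi>. norm (H \<xi>)"])
      show "AE \<xi> in lborel. norm (H \<xi> * of_real (\<psi> k \<xi>)) \<le> norm (H \<xi>)" for k
        by (auto simp: \<psi>_def norm_mult intro!: mult_left_le)
      show "AE \<xi> in lborel. (\<lambda>k. H \<xi> * of_real (\<psi> k \<xi>)) \<longlonglongrightarrow> indicator {..a} \<xi> *\<^sub>R H \<xi>"
      proof (intro AE_I2)
        fix \<xi>
        show "(\<lambda>k. H \<xi> * of_real (\<psi> k \<xi>)) \<longlonglongrightarrow> indicator {..a} \<xi> *\<^sub>R H \<xi>"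
        proof (cases "\<xi> \<le> a")
          case True
          then show ?thesis by (simp add: \<psi>_def)
        next
          case False
          have "\<forall>\<^sub>F k in sequentially. real k \<ge> 1 / (\<xi> - a)"
            by (rule filterlim_real_sequentially[unfolded filterlim_at_top, rule_format])
          then have "\<forall>\<^sub>F k in sequentially. H \<xi> * of_real (\<psi> k \<xi>) = 0"
            by eventually_elim (use False in \<open>simp add: \<psi>_def field_simps\<close>)
          then have "(\<lambda>k. H \<xi> * of_real (\<psi> k \<xi>)) \<longlonglongrightarrow> 0"
            by (rule tendsto_eventually)
          then show ?thesis using False by simp
        qed
      qed
      show "integrable lborel (\<lambda>\<xi>. norm (H \<xi>))" using H by simp
    qed (auto simp: \<psi>_def)
    moreover have "(LINT \<xi>|lborel. H \<xi> * of_real (\<psi> k \<xi>)) = 0" for k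
      unfolding \<psi>_def by (rule zero) (auto intro!: continuous_intros)
    ultimately show ?thesis
      by (simp add: set_lebesgue_integral_def LIMSEQ_const_iff)
  qed
  \<comment> \<open>The integral over the whole line is what the complement step of the induction
    subtracts from.\<close>
  have total: "(LINT \<xi>|lborel. H \<xi>) = 0"
    using zero[of "\<lambda>_. 1"] by simp
  have int: "integrable lborel (\<lambda>\<xi>. indicator A \<xi> *\<^sub>R H \<xi>)" if "A \<in> sets borel" for A
    using integrable_mult_indicator[OF _ H, of A] that by simp
  have gen: "sigma_sets UNIV (range (\<lambda>a. {..a::real})) = sets borel"
    by (simp add: borel_eq_atMost)
  have stable: "Int_stable (range (\<lambda>a::real. {..a}))"
    by (auto simp: Int_stable_def)
  have sub: "range (\<lambda>a::real. {..a}) \<subseteq> Pow UNIV" by simp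
  fix A :: "real set" assume "A \<in> sets lborel"
  then have "A \<in> sigma_sets UNIV (range (\<lambda>a. {..a::real}))"
    unfolding gen by simp
  with stable sub show "set_lebesgue_integral lborel A H = 0"
  proof (induction rule: sigma_sets_induct_disjoint)
    case (basic A)
    then show ?case using half_line by auto
  next
    case empty
    then show ?case by (simp add: set_lebesgue_integral_def)
  next
    case (compl A)
    have "(LINT \<xi>|lborel. indicator (UNIV - A) \<xi> *\<^sub>R H \<xi>) = (LINT \<xi>|lborel. H \<xi> - indicator A \<xi> *\<^sub>R H \<xi>)"
      by (intro Bochner_Integration.integral_cong) (auto simp: indicator_def)
    also have "\<dots> = 0"
      using compl(2) int[OF compl(1)[unfolded gen]] H by (simp add: total set_lebesgue_integral_def)
    finally show ?case by (simp add: set_lebesgue_integral_def)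
  next
    case (union A)
    have A: "A i \<in> sets borel" for i
      using union(2) unfolding gen by blast
    have "set_lebesgue_integral lborel (\<Union>i. A i) H = (\<Sum>i. set_lebesgue_integral lborel (A i) H)"
    proof (rule lebesgue_integral_countable_add)
      show "A i \<in> sets lborel" for i using A by simp
      show "A i \<inter> A j = {}" if "i \<noteq> j" for i j
        using disjoint_family_onD[OF union(1)] that by blast
      show "set_integrable lborel (\<Union>i. A i) H"
        unfolding set_integrable_def using A by (intro int) blast
    qed
    then show ?case using union(3) by simp
  qed
qed

text \<open>The exponential series can be integrated term by term: on the bounded support its
  \<open>n\<close>-th term is at most \<open>R ^ n / fact n\<close>, which is summable. The result
  is a power series converging everywhere.\<close>

lemma holomorphic_fourier_integral:
  fixes H :: "real \<Rightarrow> complex"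
  assumes H: "integrable lborel H" and supp: "\<And>\<xi>. H \<xi> \<noteq> 0 \<Longrightarrow> \<bar>\<xi>\<bar> \<le> B"
  shows "(\<lambda>z. LINT \<xi>|lborel. H \<xi> * exp (2 * of_real pi * \<i> * of_real \<xi> * z)) holomorphic_on UNIV"
proof -
  have [measurable]: "H \<in> borel_measurable borel" using H by simp
  define a :: "nat \<Rightarrow> complex" where
    "a n = (LINT \<xi>|lborel. H \<xi> * ((2 * of_real pi * \<i> * of_real \<xi>) ^ n / fact n))" for n
  have B: "H \<xi> = 0" if "\<not> \<bar>\<xi>\<bar> \<le> B" for \<xi> using supp that by blast
  have sums: "(\<lambda>n. a n * z ^ n) sums (LINT \<xi>|lborel. H \<xi> * exp (2 * of_real pi * \<i> * of_real \<xi> * z))" for z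
  proof -
    define T where "T n \<xi> = H \<xi> * ((2 * of_real pi * \<i> * of_real \<xi> * z) ^ n / fact n)" for n \<xi>
    \<comment> \<open>The absolute value makes \<open>R\<close> a nonnegative bound for the exponent
      on the support, whatever the sign of \<open>B\<close>.\<close>
    define R where "R = 2 * pi * \<bar>B\<bar> * norm z"
    have T_bd: "norm (T n \<xi>) \<le> norm (H \<xi>) * (R ^ n / fact n)" for n \<xi>
    proof (cases "\<bar>\<xi>\<bar> \<le> B")
      case True
      have "norm (2 * of_real pi * \<i> * of_real \<xi> * z) \<le> R"
        unfolding R_def norm_mult using True by (auto intro!: mult_mono)
      then have "norm ((2 * of_real pi * \<i> * of_real \<xi> * z) ^ n / fact n) \<le> R ^ n / fact n"
        unfolding norm_divide norm_power by (auto intro!: divide_right_mono power_mono)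
      then show ?thesis unfolding T_def norm_mult[of "H \<xi>"] by (intro mult_left_mono) auto
    qed (simp add: B T_def)
    have T_int: "integrable lborel (T n)" for n
    proof (rule Bochner_Integration.integrable_bound)
      show "integrable lborel (\<lambda>\<xi>. norm (H \<xi>) * (R ^ n / fact n))"
        using H by (intro integrable_mult_left) auto
      show "AE \<xi> in lborel. norm (T n \<xi>) \<le> norm (norm (H \<xi>) * (R ^ n / fact n))"
        by (intro AE_I2) (metis T_bd abs_ge_self order_trans real_norm_def)
    qed (unfold T_def, measurable)
    have exp_sums: "(\<lambda>n. (2 * of_real pi * \<i> * of_real \<xi> * z) ^ n / fact n) sums exp (2 * of_real pi * \<i> * of_real \<xi> * z)" for \<xi>
      using exp_converges[of "2 * of_real pi * \<i> * of_real \<xi> * z"]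
      by (simp add: scaleR_conv_of_real field_simps)
    have R_sums: "summable (\<lambda>n. R ^ n / fact n)"
      using summable_exp[of R] by (simp add: field_simps)
    have "(\<lambda>n. LINT \<xi>|lborel. T n \<xi>) sums (LINT \<xi>|lborel. (\<Sum>n. T n \<xi>))"
    proof (rule sums_integral[OF T_int])
      show "AE \<xi> in lborel. summable (\<lambda>n. norm (T n \<xi>))"
      proof (intro AE_I2)
        fix \<xi>
        show "summable (\<lambda>n. norm (T n \<xi>))"
          by (rule summable_comparison_test'[OF summable_mult[OF R_sums, of "norm (H \<xi>)"], of 0])
            (simp only: real_norm_def abs_norm_cancel T_bd)
      qed
      show "summable (\<lambda>n. LINT \<xi>|lborel. norm (T n \<xi>))"
      proof (rule summable_comparison_test')
        show "summable (\<lambda>n. (LINT \<xi>|lborel. norm (H \<xi>)) * (R ^ n / fact n))"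
          by (rule summable_mult[OF R_sums])
        have "(LINT \<xi>|lborel. norm (T n \<xi>)) \<le> (LINT \<xi>|lborel. norm (H \<xi>) * (R ^ n / fact n))" for n
          by (intro integral_mono T_bd integrable_norm T_int integrable_mult_left H)
        then show "norm (LINT \<xi>|lborel. norm (T n \<xi>)) \<le> (LINT \<xi>|lborel. norm (H \<xi>)) * (R ^ n / fact n)" for n
          by simp
      qed
    qed
    moreover have "(LINT \<xi>|lborel. T n \<xi>) = a n * z ^ n" for n
    proof -
      have "T n = (\<lambda>\<xi>. H \<xi> * ((2 * of_real pi * \<i> * of_real \<xi>) ^ n / fact n) * z ^ n)"
        by (auto simp: T_def power_mult_distrib)
      then show ?thesis by (simp add: a_def)
    qed
    moreover have "(\<Sum>n. T n \<xi>) = H \<xi> * exp (2 * of_real pi * \<i> * of_real \<xi> * z)" for \<xi>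
      unfolding T_def using sums_mult[OF exp_sums] sums_unique by metis
    ultimately show ?thesis by simp
  qed
  have "(\<lambda>z. LINT \<xi>|lborel. H \<xi> * exp (2 * of_real pi * \<i> * of_real \<xi> * z)) holomorphic_on ball 0 r" for r
    by (rule power_series_holomorphic) (use sums in simp)
  then have "(\<lambda>z. LINT \<xi>|lborel. H \<xi> * exp (2 * of_real pi * \<i> * of_real \<xi> * z)) holomorphic_on (\<Union>n::nat. ball 0 (real n))"
    by (intro holomorphic_on_UN_open) auto
  also have "(\<Union>n::nat. ball 0 (real n)) = (UNIV :: complex set)"
    using reals_Archimedean2 by auto
  finally show ?thesis .
qed

text \<open>Along the sequence \<open>1 / (n + 1)\<close> the product is 0, so one factor vanishes
  at infinitely many of its terms. The zeros of this factor accumulate at 0, and the identity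
  theorem applies.\<close>

lemma entire_mult_eq_0_on_reals:
  assumes f: "f holomorphic_on UNIV" and g: "g holomorphic_on UNIV"
    and 0: "\<And>x::real. f (of_real x) * g (of_real x) = 0"
  shows "(\<forall>z. f z = 0) \<or> (\<forall>z. g z = 0)"
proof -
  define t where "t n = complex_of_real (inverse (real (Suc n)))" for n
  have *: "\<forall>z. h z = 0" if h: "h holomorphic_on UNIV" and inf: "infinite {n. h (t n) = 0}" for h
  proof -
    have lim: "0 islimpt {z. h z = 0}"
      unfolding islimpt_approachable
    proof (intro allI impI)
      fix e :: real assume "e > 0"
      then obtain N where N: "inverse (real (Suc N)) < e" using reals_Archimedean by blast
      obtain n where n: "n > N" "h (t n) = 0"
        using inf by (auto simp: infinite_nat_iff_unbounded)
      have "inverse (real (Suc n)) < inverse (real (Suc N))"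
        using n by (intro less_imp_inverse_less) auto
      then have "norm (t n) < e" using N by (simp only: t_def norm_of_real abs_of_nonneg inverse_nonnegative_iff_nonnegative of_nat_0_le_iff)
      moreover have "t n \<noteq> 0" by (simp add: t_def del: of_nat_Suc)
      ultimately show "\<exists>z\<in>{z. h z = 0}. z \<noteq> 0 \<and> dist z 0 < e"
        using n by auto
    qed
    show ?thesis
      using analytic_continuation[OF h open_UNIV connected_UNIV subset_UNIV UNIV_I lim] by blast
  qed
  have "{n. f (t n) = 0} \<union> {n. g (t n) = 0} = UNIV"
    using 0[of "inverse (real (Suc n))" for n, folded t_def] by (auto simp del: of_real_inverse)
  then have "\<not> finite ({n. f (t n) = 0} \<union> {n. g (t n) = 0})"
    by (simp only: infinite_UNIV_nat not_False_eq_True)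
  then have "infinite {n. f (t n) = 0} \<or> infinite {n. g (t n) = 0}"
    by (simp only: finite_Un de_Morgan_conj)
  then show ?thesis
  proof
    assume "infinite {n. f (t n) = 0}"
    from *[OF f this] show ?thesis by (rule disjI1)
  next
    assume "infinite {n. g (t n) = 0}"
    from *[OF g this] show ?thesis by (rule disjI2)
  qed
qed

section \<open>Sampling the product of two Fourier integrals\<close>

lemma integrable_mult_cis:
  assumes "integrable M K" and [measurable]: "u \<in> borel_measurable M"
  shows "integrable M (\<lambda>w. K w * cis (u w))"
proof (rule Bochner_Integration.integrable_bound[OF assms(1)])
  have [measurable]: "cis \<in> borel_measurable borel"
    by (intro borel_measurable_continuous_onI continuous_intros)
  have [measurable]: "K \<in> borel_measurable M" using assms by simp
  show "(\<lambda>w. K w * cis (u w)) \<in> borel_measurable M" by measurable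
qed (simp add: norm_mult)

text \<open>Passes from integer frequencies to every real frequency \<open>s\<close>: the real and
  imaginary parts of \<open>cis (s * u w)\<close> are bounded continuous functions of
  \<open>u w\<close>, so the result on the interval applies to each.\<close>

lemma integral_mult_cis_eq_0:
  fixes K :: "'a \<Rightarrow> complex" and u :: "'a \<Rightarrow> real"
  assumes K: "integrable M K" and u [measurable]: "u \<in> borel_measurable M"
    and supp: "\<And>w. K w \<noteq> 0 \<Longrightarrow> \<bar>u w\<bar> < pi"
    and zero: "\<And>n::int. (LINT w|M. K w * cis (of_int n * u w)) = 0"
  shows "(LINT w|M. K w * cis (s * u w)) = 0"
proof -
  have [measurable]: "K \<in> borel_measurable M" using K by simp
  have int: "integrable M (\<lambda>w. K w * of_real (\<psi> (s * u w)))"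
    if [measurable]: "\<psi> \<in> borel_measurable borel" and "\<And>x. \<bar>\<psi> x\<bar> \<le> 1" for \<psi> :: "real \<Rightarrow> real"
    by (rule Bochner_Integration.integrable_bound[OF K]) (auto simp: norm_mult that intro!: mult_left_le)
  have "(LINT w|M. K w * cis (s * u w))
      = (LINT w|M. K w * of_real (cos (s * u w)) + \<i> * (K w * of_real (sin (s * u w))))"
    by (intro Bochner_Integration.integral_cong) (auto simp: complex_eq_iff)
  also have "\<dots> = (LINT w|M. K w * of_real (cos (s * u w))) + \<i> * (LINT w|M. K w * of_real (sin (s * u w)))"
    using int[of cos] int[of sin] by simp
  also have "(LINT w|M. K w * of_real (cos (s * u w))) = 0"
    by (rule integral_eq_0_interval[OF K u supp zero, where \<psi> = "\<lambda>x. cos (s * x)" and C = 1])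
      (auto intro!: continuous_intros)
  also have "(LINT w|M. K w * of_real (sin (s * u w))) = 0"
    by (rule integral_eq_0_interval[OF K u supp zero, where \<psi> = "\<lambda>x. sin (s * x)" and C = 1])
      (auto intro!: continuous_intros)
  finally show ?thesis by simp
qed

text \<open>Scaling the band to \<open>(-pi, pi)\<close> turns the values at
  \<open>x = n / (2 * B)\<close> into Fourier coefficients. Their vanishing makes \<open>H\<close>
  orthogonal to all bounded continuous functions.\<close>

lemma AE_eq_0_if_fourier_integral_0:
  fixes H :: "real \<Rightarrow> complex"
  assumes H: "integrable lborel H" and supp: "\<And>\<xi>. H \<xi> \<noteq> 0 \<Longrightarrow> \<bar>\<xi>\<bar> < B" and B: "B > 0"
    and zero: "\<And>x. (LINT \<xi>|lborel. H \<xi> * cis (2 * pi * x * \<xi>)) = 0"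
  shows "AE \<xi> in lborel. H \<xi> = 0"
proof (rule AE_eq_0_if_integral_continuous_0[OF H])
  fix \<psi> :: "real \<Rightarrow> real" assume \<psi>: "continuous_on UNIV \<psi>" "\<And>x. \<bar>\<psi> x\<bar> \<le> 1"
  have "(LINT \<xi>|lborel. H \<xi> * of_real (\<psi> (B / pi * (pi / B * \<xi>)))) = 0"
  proof (rule integral_eq_0_interval[OF H, where \<psi> = "\<lambda>x. \<psi> (B / pi * x)" and C = 1])
    show "\<bar>pi / B * \<xi>\<bar> < pi" if "H \<xi> \<noteq> 0" for \<xi>
      using supp[OF that] B by (simp add: abs_mult field_simps)
    show "(LINT \<xi>|lborel. H \<xi> * cis (of_int n * (pi / B * \<xi>))) = 0" for n :: int
      using zero[of "of_int n / (2 * B)"] B by (simp add: field_simps)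
    show "continuous_on UNIV (\<lambda>x. \<psi> (B / pi * x))"
      by (intro continuous_on_compose2[OF \<psi>(1)] continuous_intros) auto
  qed (auto simp: \<psi>)
  then show "(LINT \<xi>|lborel. H \<xi> * of_real (\<psi> \<xi>)) = 0" using B by simp
qed

text \<open>By Fubini the product is an integral over the plane of the tensor product
  \<open>K\<close>, whose phase depends only on \<open>\<xi> + \<eta>\<close>. This sum lies in
  \<open>(-2B, 2B)\<close>, so the samples at spacing \<open>1 / (4 * B)\<close> are all the Fourier
  coefficients. Working on the plane replaces the convolution of the two spectra.\<close>

lemma fourier_integral_product_eq_0:
  fixes H\<^sub>1 H\<^sub>2 :: "real \<Rightarrow> complex"
  assumes H1: "integrable lborel H\<^sub>1" and H2: "integrable lborel H\<^sub>2"
    and supp: "\<And>\<xi>. H\<^sub>1 \<xi> \<noteq> 0 \<Longrightarrow> \<bar>\<xi>\<bar> < B" "\<And>\<xi>. H\<^sub>2 \<xi> \<noteq> 0 \<Longrightarrow> \<bar>\<xi>\<bar> < B" and B: "B > 0"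
    and zero: "\<And>n::int. (LINT \<xi>|lborel. H\<^sub>1 \<xi> * cis (2 * pi * (of_int n / (4 * B)) * \<xi>)) *
        (LINT \<xi>|lborel. H\<^sub>2 \<xi> * cis (2 * pi * (of_int n / (4 * B)) * \<xi>)) = 0"
  shows "(LINT \<xi>|lborel. H\<^sub>1 \<xi> * cis (2 * pi * x * \<xi>)) * (LINT \<xi>|lborel. H\<^sub>2 \<xi> * cis (2 * pi * x * \<xi>)) = 0"
proof -
  have [measurable]: "H\<^sub>1 \<in> borel_measurable borel" "H\<^sub>2 \<in> borel_measurable borel"
    using H1 H2 by simp_all
  define K where "K w = H\<^sub>1 (fst w) * H\<^sub>2 (snd w)" for w
  \<comment> \<open>The scaling maps \<open>(-2B, 2B)\<close> to \<open>(-pi, pi)\<close>. The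
    frequency for position \<open>y\<close> becomes \<open>4 * B * y\<close>, which is the integer
    \<open>n\<close> at \<open>y = n / (4 * B)\<close>.\<close>
  define u where "u w = pi / (2 * B) * (fst w + snd w)" for w
  have u [measurable]: "u \<in> borel_measurable (lborel \<Otimes>\<^sub>M lborel)"
    unfolding u_def by measurable
  have K: "integrable (lborel \<Otimes>\<^sub>M lborel) K"
  proof (rule lborel_pair.Fubini_integrable)
    show "K \<in> borel_measurable (lborel \<Otimes>\<^sub>M lborel)" unfolding K_def by measurable
  qed (use H1 H2 in \<open>auto simp: K_def norm_mult\<close>)
  have prod: "(LINT w|(lborel \<Otimes>\<^sub>M lborel). K w * cis (4 * B * y * u w))
      = (LINT \<xi>|lborel. H\<^sub>1 \<xi> * cis (2 * pi * y * \<xi>)) * (LINT \<xi>|lborel. H\<^sub>2 \<xi> * cis (2 * pi * y * \<xi>))" for y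
  proof -
    have "(LINT w|(lborel \<Otimes>\<^sub>M lborel). K w * cis (4 * B * y * u w))
        = (LINT \<xi>|lborel. LINT \<eta>|lborel. K (\<xi>, \<eta>) * cis (4 * B * y * u (\<xi>, \<eta>)))"
      by (rule lborel_pair.integral_fst'[symmetric]) (intro integrable_mult_cis K; measurable)
    also have "\<dots> = (LINT \<xi>|lborel. LINT \<eta>|lborel. (H\<^sub>1 \<xi> * cis (2 * pi * y * \<xi>)) * (H\<^sub>2 \<eta> * cis (2 * pi * y * \<eta>)))"
    proof (intro Bochner_Integration.integral_cong refl)
      fix \<xi> \<eta>
      have "4 * B * y * u (\<xi>, \<eta>) = 2 * pi * y * \<xi> + 2 * pi * y * \<eta>"
        using B by (simp add: u_def field_simps)
      then show "K (\<xi>, \<eta>) * cis (4 * B * y * u (\<xi>, \<eta>)) = (H\<^sub>1 \<xi> * cis (2 * pi * y * \<xi>)) * (H\<^sub>2 \<eta> * cis (2 * pi * y * \<eta>))"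
        by (simp add: K_def mult_ac flip: cis_mult)
    qed
    also have "\<dots> = (LINT \<xi>|lborel. H\<^sub>1 \<xi> * cis (2 * pi * y * \<xi>)) * (LINT \<xi>|lborel. H\<^sub>2 \<xi> * cis (2 * pi * y * \<xi>))"
      by simp
    finally show ?thesis .
  qed
  have "(LINT w|(lborel \<Otimes>\<^sub>M lborel). K w * cis (4 * B * x * u w)) = 0"
  proof (rule integral_mult_cis_eq_0[OF K u])
    fix w assume "K w \<noteq> 0"
    then have "\<bar>fst w\<bar> < B" "\<bar>snd w\<bar> < B" using supp by (auto simp: K_def)
    then have "\<bar>fst w + snd w\<bar> < 2 * B" by linarith
    then have "pi / (2 * B) * \<bar>fst w + snd w\<bar> < pi / (2 * B) * (2 * B)"
      using B by (intro mult_strict_left_mono) auto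
    then show "\<bar>u w\<bar> < pi" using B by (simp add: u_def abs_mult)
  next
    fix n :: int
    have "4 * B * (of_int n / (4 * B)) = of_int n" using B by simp
    then show "(LINT w|(lborel \<Otimes>\<^sub>M lborel). K w * cis (of_int n * u w)) = 0"
      using prod[of "of_int n / (4 * B)"] zero[of n] by (simp only:)
  qed
  then show ?thesis by (simp only: prod)
qed

text \<open>The product of the two Fourier integrals vanishes on the whole real line. Both extend to
  entire functions, so one of them is identically 0, and uniqueness yields its spectrum.\<close>

lemma AE_eq_0_if_samples_product_0:
  fixes H\<^sub>1 H\<^sub>2 :: "real \<Rightarrow> complex"
  assumes H1: "integrable lborel H\<^sub>1" and H2: "integrable lborel H\<^sub>2"
    and supp: "\<And>\<xi>. H\<^sub>1 \<xi> \<noteq> 0 \<Longrightarrow> \<bar>\<xi>\<bar> < B" "\<And>\<xi>. H\<^sub>2 \<xi> \<noteq> 0 \<Longrightarrow> \<bar>\<xi>\<bar> < B" and B: "B > 0"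
    and zero: "\<And>n::int. (LINT \<xi>|lborel. H\<^sub>1 \<xi> * cis (2 * pi * (of_int n / (4 * B)) * \<xi>)) *
        (LINT \<xi>|lborel. H\<^sub>2 \<xi> * cis (2 * pi * (of_int n / (4 * B)) * \<xi>)) = 0"
  shows "(AE \<xi> in lborel. H\<^sub>1 \<xi> = 0) \<or> (AE \<xi> in lborel. H\<^sub>2 \<xi> = 0)"
proof -
  define V where "V H z = (LINT \<xi>|lborel. H \<xi> * exp (2 * of_real pi * \<i> * of_real \<xi> * z))" for H z
  have V_real: "V H (of_real x) = (LINT \<xi>|lborel. H \<xi> * cis (2 * pi * x * \<xi>))" for H x
    unfolding V_def by (intro Bochner_Integration.integral_cong) (auto simp: cis_conv_exp mult_ac)
  have "V H\<^sub>1 holomorphic_on UNIV" "V H\<^sub>2 holomorphic_on UNIV"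
    unfolding V_def using holomorphic_fourier_integral[of _ B] H1 H2 supp by (simp_all add: less_imp_le)
  moreover have "V H\<^sub>1 (of_real x) * V H\<^sub>2 (of_real x) = 0" for x
    unfolding V_real using fourier_integral_product_eq_0[OF H1 H2 supp B zero] .
  ultimately have "(\<forall>z. V H\<^sub>1 z = 0) \<or> (\<forall>z. V H\<^sub>2 z = 0)"
    by (rule entire_mult_eq_0_on_reals)
  then show ?thesis
    using AE_eq_0_if_fourier_integral_0[OF H1 supp(1) B] AE_eq_0_if_fourier_integral_0[OF H2 supp(2) B]
    by (auto simp flip: V_real)
qed

section \<open>The short-time Fourier transform of a band-limited function\<close>

text \<open>If the positive part had infinite integral, the interval \<open>[-n, n]\<close> could be enlarged by so much of the set
  where \<open>k > 0\<close> that the truncated integrals exceed \<open>n\<close>.\<close>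

lemma integrable_max_0_if_truncations_converge:
  fixes k :: "real \<Rightarrow> real"
  assumes [measurable]: "k \<in> borel_measurable borel"
    and loc: "\<And>A. A \<in> sets borel \<Longrightarrow> bounded A \<Longrightarrow> integrable lborel (\<lambda>t. indicator A t * k t)"
    and conv: "\<And>A :: nat \<Rightarrow> real set. (\<And>n. A n \<in> sets borel) \<Longrightarrow> (\<And>n. bounded (A n)) \<Longrightarrow>
        (\<And>n. {- real n..real n} \<subseteq> A n) \<Longrightarrow> (\<lambda>n. LINT t|lborel. indicator (A n) t * k t) \<longlonglongrightarrow> c"
  shows "integrable lborel (\<lambda>t. max 0 (k t))"
proof (rule ccontr)
  assume not_int: "\<not> integrable lborel (\<lambda>t. max 0 (k t))"
  define I where "I n = {- real n..real n}" for n
  define p where "p n t = indicator (I n) t * max 0 (k t)" for n t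
  have I_meas [measurable]: "I n \<in> sets borel" for n by (simp add: I_def)
  have I: "integrable lborel (\<lambda>t. indicator (I n) t * k t)" for n
    by (rule loc) (simp_all add: I_def)
  have p_eq: "p n t = max 0 (indicator (I n) t * k t)" for n t
    by (auto simp: p_def indicator_def)
  have p_int: "integrable lborel (p n)" for n
    unfolding p_eq[abs_def] using I by (intro Bochner_Integration.integrable_max) auto
  have k_int: "integrable lborel (\<lambda>t. indicator (I n) t * \<bar>k t\<bar>)" for n
    using integrable_abs[OF I[of n]] by (simp add: abs_mult)
  have p_mono: "p m t \<le> p n t" if "m \<le> n" for m n t
    using that by (auto simp: p_def I_def indicator_def)
  \<comment> \<open>Otherwise monotone convergence would make the positive part integrable.\<close>
  have "\<exists>m. (LINT t|lborel. p m t) > R" for R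
  proof (rule ccontr)
    assume "\<not> (\<exists>m. (LINT t|lborel. p m t) > R)"
    then have bdd: "(LINT t|lborel. p m t) \<le> R" for m by (simp add: not_less)
    have "incseq (\<lambda>m. LINT t|lborel. p m t)"
      by (intro incseq_SucI integral_mono p_int p_mono) simp
    then obtain l where l: "(\<lambda>m. LINT t|lborel. p m t) \<longlonglongrightarrow> l"
      by (rule incseq_convergent[where B = R]) (use bdd in auto)
    have "integrable lborel (\<lambda>t. max 0 (k t))"
    proof (rule integrable_monotone_convergence[OF p_int _ _ l])
      show "AE t in lborel. mono (\<lambda>n. p n t)" using p_mono by (auto simp: mono_def)
      show "AE t in lborel. (\<lambda>n. p n t) \<longlonglongrightarrow> max 0 (k t)"
      proof (intro AE_I2 tendsto_eventually)
        fix t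
        have "\<forall>\<^sub>F n in sequentially. real n \<ge> \<bar>t\<bar>"
          by (rule filterlim_real_sequentially[unfolded filterlim_at_top, rule_format])
        then show "\<forall>\<^sub>F n in sequentially. p n t = max 0 (k t)"
          by eventually_elim (auto simp: p_def I_def indicator_def)
      qed
    qed simp
    with not_int show False by blast
  qed
  \<comment> \<open>The integral of \<open>\<bar>k t\<bar>\<close> over \<open>I n\<close>
    compensates for the negative values of \<open>k\<close> there, so that the enlarged set still
    gives more than \<open>n\<close>.\<close>
  then have "\<forall>n. \<exists>m. (LINT t|lborel. p m t) > real n + (LINT t|lborel. indicator (I n) t * \<bar>k t\<bar>)" by blast
  then obtain m where m: "\<And>n. (LINT t|lborel. p (m n) t) > real n + (LINT t|lborel. indicator (I n) t * \<bar>k t\<bar>)"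
    by metis
  define A where "A n = I n \<union> (I (m n) \<inter> {t. k t > 0})" for n
  have A_meas [measurable]: "A n \<in> sets borel" for n unfolding A_def by measurable
  have A_bdd: "bounded (A n)" for n
    unfolding A_def by (rule bounded_subset[of "I n \<union> I (m n)"]) (auto simp: I_def)
  have "(\<lambda>n. LINT t|lborel. indicator (A n) t * k t) \<longlonglongrightarrow> c"
    by (rule conv[OF A_meas A_bdd]) (auto simp: A_def I_def)
  then have "\<forall>\<^sub>F n in sequentially. (LINT t|lborel. indicator (A n) t * k t) < c + 1"
    by (rule order_tendstoD) simp
  moreover have "\<forall>\<^sub>F n in sequentially. real n \<ge> c + 1"
    by (rule filterlim_real_sequentially[unfolded filterlim_at_top, rule_format])
  ultimately have "\<forall>\<^sub>F n::nat in sequentially. False"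
  proof eventually_elim
    case (elim n)
    have "real n < (LINT t|lborel. p (m n) t) - (LINT t|lborel. indicator (I n) t * \<bar>k t\<bar>)"
      using m[of n] by simp
    also have "\<dots> = (LINT t|lborel. p (m n) t - indicator (I n) t * \<bar>k t\<bar>)"
      by (rule Bochner_Integration.integral_diff[symmetric]) (intro p_int k_int)+
    \<comment> \<open>This holds pointwise: on \<open>I n\<close> because
      \<open>max 0 (k t) - \<bar>k t\<bar> \<le> k t\<close>, and outside \<open>I n\<close> with
      equality.\<close>
    also have "\<dots> \<le> (LINT t|lborel. indicator (A n) t * k t)"
      by (intro integral_mono Bochner_Integration.integrable_diff p_int k_int loc A_meas A_bdd)
        (auto simp: p_def A_def indicator_def)
    finally show False using elim by simp
  qed
  then show False by simp
qed

text \<open>The criterion applied to \<open>k\<close> and \<open>- k\<close> bounds both parts. Once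
  \<open>k\<close> is integrable, dominated convergence along \<open>[-n, n]\<close> identifies the
  integral with \<open>c\<close>.\<close>

lemma has_bochner_integral_if_truncations_converge:
  fixes k :: "real \<Rightarrow> real"
  assumes [measurable]: "k \<in> borel_measurable borel"
    and loc: "\<And>A. A \<in> sets borel \<Longrightarrow> bounded A \<Longrightarrow> integrable lborel (\<lambda>t. indicator A t * k t)"
    and conv: "\<And>A :: nat \<Rightarrow> real set. (\<And>n. A n \<in> sets borel) \<Longrightarrow> (\<And>n. bounded (A n)) \<Longrightarrow>
        (\<And>n. {- real n..real n} \<subseteq> A n) \<Longrightarrow> (\<lambda>n. LINT t|lborel. indicator (A n) t * k t) \<longlonglongrightarrow> c"
  shows "has_bochner_integral lborel k c"
proof -
  have pos: "integrable lborel (\<lambda>t. max 0 (k t))"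
    by (rule integrable_max_0_if_truncations_converge[OF assms])
  have neg: "integrable lborel (\<lambda>t. max 0 (- k t))"
  proof (rule integrable_max_0_if_truncations_converge)
    show "integrable lborel (\<lambda>t. indicator A t * - k t)" if "A \<in> sets borel" "bounded A" for A
      using loc[OF that] by simp
    show "(\<lambda>n. LINT t|lborel. indicator (A n) t * - k t) \<longlonglongrightarrow> - c"
      if "\<And>n. A n \<in> sets borel" "\<And>n. bounded (A n)" "\<And>n. {- real n..real n} \<subseteq> A n" for A
      using tendsto_minus[OF conv[OF that]] by simp
  qed measurable
  have "integrable lborel (\<lambda>t. max 0 (k t) - max 0 (- k t))"
    by (intro Bochner_Integration.integrable_diff pos neg)
  moreover have "(\<lambda>t. max 0 (k t) - max 0 (- k t)) = k" by (auto simp: max_def)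
  ultimately have k: "integrable lborel k" by simp
  have "(\<lambda>n. LINT t|lborel. indicator {- real n..real n} t * k t) \<longlonglongrightarrow> (LINT t|lborel. k t)"
  proof (rule integral_dominated_convergence[where w = "\<lambda>t. \<bar>k t\<bar>"])
    show "AE t in lborel. (\<lambda>n. indicator {- real n..real n} t * k t) \<longlonglongrightarrow> k t"
    proof (intro AE_I2 tendsto_eventually)
      fix t
      have "\<forall>\<^sub>F n in sequentially. real n \<ge> \<bar>t\<bar>"
        by (rule filterlim_real_sequentially[unfolded filterlim_at_top, rule_format])
      then show "\<forall>\<^sub>F n in sequentially. indicator {- real n..real n} t * k t = k t"
        by eventually_elim (auto simp: indicator_def)
    qed
  qed (use k in \<open>auto simp: indicator_def\<close>)
  moreover have "(\<lambda>n. LINT t|lborel. indicator {- real n..real n} t * k t) \<longlonglongrightarrow> c"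
    by (rule conv) auto
  ultimately have "(LINT t|lborel. k t) = c" by (rule LIMSEQ_unique)
  with k show ?thesis by (simp add: has_bochner_integral_iff)
qed

section \<open>Limits in L2 and the Paley-Wiener representation\<close>

text \<open>Cauchy-Schwarz bounds the L1 distance \<open>X n\<close> of the products by the L2 norm
  of \<open>F\<close> and the L2 distance of \<open>g n\<close> and \<open>G\<close>. Integrability
  of the limit product follows by comparison with a single \<open>n\<close> at which
  \<open>X n\<close> is finite.\<close>

lemma L2_tendsto_weak:
  fixes F G :: "real \<Rightarrow> complex" and g :: "nat \<Rightarrow> real \<Rightarrow> complex"
  assumes F: "F \<in> borel_measurable lborel" "integrable lborel (\<lambda>\<xi>. (cmod (F \<xi>))\<^sup>2)"
    and G: "G \<in> borel_measurable lborel"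
    and g: "\<And>n. g n \<in> borel_measurable lborel" "\<And>n. integrable lborel (\<lambda>\<xi>. F \<xi> * g n \<xi>)"
    and lim: "(\<lambda>n. L2_dist_sq (g n) G) \<longlonglongrightarrow> 0"
  shows "integrable lborel (\<lambda>\<xi>. F \<xi> * G \<xi>)"
    and "(\<lambda>n. LINT \<xi>|lborel. F \<xi> * g n \<xi>) \<longlonglongrightarrow> (LINT \<xi>|lborel. F \<xi> * G \<xi>)"
proof -
  have [measurable]: "F \<in> borel_measurable borel" "G \<in> borel_measurable borel" "g n \<in> borel_measurable borel" for n
    using F G g by simp_all
  define X where "X n = (\<integral>\<^sup>+ \<xi>. ennreal (norm (F \<xi> * g n \<xi> - F \<xi> * G \<xi>)) \<partial>lborel)" for n
  define S where "S = (\<integral>\<^sup>+ \<xi>. ennreal ((cmod (F \<xi>))\<^sup>2) \<partial>lborel)"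
  have "S < top" unfolding S_def using F(2) by (simp add: integrable_iff_bounded)
  have X: "(X n)\<^sup>2 \<le> S * L2_dist_sq (g n) G" for n
  proof -
    have "X n = (\<integral>\<^sup>+ \<xi>. ennreal (cmod (F \<xi>)) * ennreal (cmod (g n \<xi> - G \<xi>)) \<partial>lborel)"
      unfolding X_def by (intro nn_integral_cong) (simp add: norm_mult ennreal_mult flip: right_diff_distrib)
    then show ?thesis
      using Cauchy_Schwarz_nn_integral[of "\<lambda>\<xi>. ennreal (cmod (F \<xi>))" lborel "\<lambda>\<xi>. ennreal (cmod (g n \<xi> - G \<xi>))"]
      by (simp add: S_def L2_dist_sq_def ennreal_power)
  qed
  have "(\<lambda>n. S * L2_dist_sq (g n) G) \<longlonglongrightarrow> S * 0"
    using \<open>S < top\<close> by (intro ennreal_tendsto_cmult lim)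
  then have "(\<lambda>n. S * L2_dist_sq (g n) G) \<longlonglongrightarrow> 0" by simp
  then have X2: "(\<lambda>n. (X n)\<^sup>2) \<longlonglongrightarrow> 0"
    by (rule tendsto_sandwich[OF _ _ tendsto_const, rotated 2]) (auto simp: X)
  have X_lim: "X \<longlonglongrightarrow> 0"
  proof (rule order_tendstoI)
    fix a :: ennreal assume "0 < a"
    then have "0 < a\<^sup>2" by (simp add: power2_eq_square ennreal_zero_less_mult_iff)
    with X2 have "\<forall>\<^sub>F n in sequentially. (X n)\<^sup>2 < a\<^sup>2" by (rule order_tendstoD)
    then show "\<forall>\<^sub>F n in sequentially. X n < a"
    proof eventually_elim
      case (elim n)
      show ?case
      proof (rule ccontr)
        assume "\<not> X n < a"
        then have "a\<^sup>2 \<le> (X n)\<^sup>2" by (intro power_mono) auto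
        with elim show False by simp
      qed
    qed
  qed simp
  then have "\<forall>\<^sub>F n in sequentially. X n < top" by (rule order_tendstoD) simp
  then obtain n where "X n < top" by (auto simp: eventually_sequentially)
  then have "integrable lborel (\<lambda>\<xi>. F \<xi> * g n \<xi> - F \<xi> * G \<xi>)"
    by (simp add: integrable_iff_bounded X_def)
  from Bochner_Integration.integrable_diff[OF g(2)[of n] this]
  show int: "integrable lborel (\<lambda>\<xi>. F \<xi> * G \<xi>)" by simp
  show "(\<lambda>n. LINT \<xi>|lborel. F \<xi> * g n \<xi>) \<longlonglongrightarrow> (LINT \<xi>|lborel. F \<xi> * G \<xi>)"
    by (rule tendsto_L1_int[OF g(2) int]) (use X_lim in \<open>simp add: X_def[abs_def]\<close>)
qed

lemma integrable_if_square_integrable_bounded_support: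
  fixes F :: "real \<Rightarrow> complex"
  assumes "F \<in> borel_measurable borel" "integrable lborel (\<lambda>\<xi>. (cmod (F \<xi>))\<^sup>2)"
    and "A \<in> sets borel" "bounded A" and "\<And>\<xi>. F \<xi> \<noteq> 0 \<Longrightarrow> \<xi> \<in> A"
  shows "integrable lborel F"
proof (rule Bochner_Integration.integrable_bound)
  have "emeasure lborel A < \<infinity>" using \<open>bounded A\<close> by (rule emeasure_bounded_finite)
  then show "integrable lborel (\<lambda>\<xi>. indicator A \<xi> + (cmod (F \<xi>))\<^sup>2)"
    using assms by (intro Bochner_Integration.integrable_add) auto
  have bound: "norm (F \<xi>) \<le> 1 + (cmod (F \<xi>))\<^sup>2" for \<xi>
    \<comment> \<open>Expanding the square gives
      \<open>cmod (F \<xi>) \<le> (cmod (F \<xi>))\<^sup>2 + 1 / 4\<close>.\<close>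
    using zero_le_power2[of "cmod (F \<xi>) - 1 / 2"] by (simp add: power2_eq_square field_simps)
  show "AE \<xi> in lborel. norm (F \<xi>) \<le> norm (indicator A \<xi> + (cmod (F \<xi>))\<^sup>2)"
  proof (intro AE_I2)
    fix \<xi>
    show "norm (F \<xi>) \<le> norm (indicator A \<xi> + (cmod (F \<xi>))\<^sup>2)"
      by (cases "F \<xi> = 0") (use assms(5)[of \<xi>] bound[of \<xi>] in simp_all)
  qed
qed (use assms in simp)

text \<open>Extends the spectrum by 0 to the whole line and removes the endpoints, a null set. The
  strict support bound is what later keeps the scaled phase off the branch cut of
  \<open>Arg\<close>.\<close>

lemma PW_representation:
  assumes "f \<in> PW B"
  obtains F where "F \<in> borel_measurable borel" "\<And>\<xi>. F \<xi> \<noteq> 0 \<Longrightarrow> \<bar>\<xi>\<bar> < B"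
    "integrable lborel (\<lambda>\<xi>. (cmod (F \<xi>))\<^sup>2)"
    "\<And>z. f z = (LINT \<xi>|lborel. F \<xi> * exp (2 * of_real pi * \<i> * of_real \<xi> * z))"
proof -
  obtain F where F: "set_borel_measurable lborel {-B..B} F"
    "set_integrable lborel {-B..B} (\<lambda>\<xi>. (cmod (F \<xi>))\<^sup>2)"
    "\<And>z. f z = (LINT \<xi>:{-B..B}|lborel. F \<xi> * exp (2 * of_real pi * \<i> * of_real \<xi> * z))"
    using assms unfolding PW_def by blast
  define F' where "F' \<xi> = indicator {-B<..<B} \<xi> *\<^sub>R F \<xi>" for \<xi>
  \<comment> \<open>Measurability is known for the restriction to \<open>{-B..B}\<close>, so that of
    \<open>F'\<close> is derived through \<open>E\<close>.\<close>
  define E where "E \<xi> = indicator {-B..B} \<xi> *\<^sub>R F \<xi>" for \<xi>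
  have [measurable]: "E \<in> borel_measurable borel"
    using F(1) by (simp add: set_borel_measurable_def E_def[abs_def])
  have F'_E: "F' \<xi> = indicator {-B<..<B} \<xi> *\<^sub>R E \<xi>" for \<xi> by (auto simp: F'_def E_def indicator_def)
  have F' [measurable]: "F' \<in> borel_measurable borel" unfolding F'_E[abs_def] by measurable
  show thesis
  proof
    show "\<bar>\<xi>\<bar> < B" if "F' \<xi> \<noteq> 0" for \<xi>
      using that by (auto simp: F'_def indicator_def split: if_splits)
    show "integrable lborel (\<lambda>\<xi>. (cmod (F' \<xi>))\<^sup>2)"
    proof (rule Bochner_Integration.integrable_bound[OF F(2)[unfolded set_integrable_def]])
      show "(\<lambda>\<xi>. (cmod (F' \<xi>))\<^sup>2) \<in> borel_measurable lborel" by measurable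
    qed (auto simp: F'_def indicator_def)
    fix z
    have endpoints: "AE \<xi> in lborel. \<xi> \<noteq> -B \<and> \<xi> \<noteq> B"
      using AE_lborel_singleton[of "-B"] AE_lborel_singleton[of B] by eventually_elim simp
    have "(LINT \<xi>|lborel. E \<xi> * exp (2 * of_real pi * \<i> * of_real \<xi> * z))
        = (LINT \<xi>|lborel. F' \<xi> * exp (2 * of_real pi * \<i> * of_real \<xi> * z))"
    proof (intro integral_cong_AE)
      show "AE \<xi> in lborel. E \<xi> * exp (2 * of_real pi * \<i> * of_real \<xi> * z)
          = F' \<xi> * exp (2 * of_real pi * \<i> * of_real \<xi> * z)"
        using endpoints by eventually_elim (auto simp: F'_def E_def indicator_def)
    qed measurable
    then show "f z = (LINT \<xi>|lborel. F' \<xi> * exp (2 * of_real pi * \<i> * of_real \<xi> * z))"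
      by (simp add: F(3) set_lebesgue_integral_def E_def)
  qed (rule F')
qed

section \<open>The Parseval formula for the window\<close>

lemma cnj_fourier_L1_of_real:
  "cnj (fourier_L1 (\<lambda>t. complex_of_real (h t)) \<xi>) = (LINT t|lborel. complex_of_real (h t) * cis (2 * pi * t * \<xi>))"
proof -
  have "cnj (fourier_L1 (\<lambda>t. complex_of_real (h t)) \<xi>)
      = (LINT t|lborel. cnj (complex_of_real (h t) * exp (- (2 * of_real pi * \<i> * of_real t * of_real \<xi>))))"
    unfolding fourier_L1_def by (rule Bochner_Integration.integral_cnj[symmetric])
  also have "\<dots> = (LINT t|lborel. complex_of_real (h t) * cis (2 * pi * t * \<xi>))"
  proof (intro Bochner_Integration.integral_cong refl)
    fix t
    have "exp (- (2 * complex_of_real pi * \<i> * of_real t * of_real \<xi>)) = cis (- (2 * pi * t * \<xi>))"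
      by (simp add: cis_conv_exp mult_ac)
    then show "cnj (complex_of_real (h t) * exp (- (2 * of_real pi * \<i> * of_real t * of_real \<xi>)))
        = complex_of_real (h t) * cis (2 * pi * t * \<xi>)"
      by (simp add: complex_eq_iff)
  qed
  finally show ?thesis .
qed

lemma fourier_L1_measurable:
  assumes [measurable]: "h \<in> borel_measurable borel"
  shows "fourier_L1 h \<in> borel_measurable borel"
  unfolding fourier_L1_def[abs_def] by measurable

text \<open>Dominated convergence with majorant \<open>(cmod (\<phi> t))\<^sup>2\<close>: each point
  eventually lies in \<open>A n\<close>. The sets stay general because the integrability criterion
  asks for all such truncations.\<close>

lemma L2_dist_sq_truncation_tendsto_0:
  fixes \<phi> :: "real \<Rightarrow> complex"
  assumes \<phi>: "square_integrable \<phi>" and [measurable]: "\<And>n. A n \<in> sets borel" and A: "\<And>n. {- real n..real n} \<subseteq> A n"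
  shows "(\<lambda>n. L2_dist_sq (\<lambda>t. indicator (A n) t * \<phi> t) \<phi>) \<longlonglongrightarrow> 0"
proof -
  have [measurable]: "\<phi> \<in> borel_measurable borel" using \<phi> by (simp add: square_integrable_def)
  have "(\<lambda>n. \<integral>\<^sup>+ t. ennreal ((cmod (indicator (A n) t * \<phi> t - \<phi> t))\<^sup>2) \<partial>lborel) \<longlonglongrightarrow> (\<integral>\<^sup>+ t. 0 \<partial>(lborel :: real measure))"
  proof (rule nn_integral_dominated_convergence[where w = "\<lambda>t. ennreal ((cmod (\<phi> t))\<^sup>2)"])
    show "(\<integral>\<^sup>+ t. ennreal ((cmod (\<phi> t))\<^sup>2) \<partial>lborel) < \<infinity>"
      using \<phi> by (simp add: square_integrable_def integrable_iff_bounded)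
    show "AE t in lborel. (\<lambda>n. ennreal ((cmod (indicator (A n) t * \<phi> t - \<phi> t))\<^sup>2)) \<longlonglongrightarrow> 0"
    proof (intro AE_I2 tendsto_eventually)
      fix t
      have "\<forall>\<^sub>F n in sequentially. real n \<ge> \<bar>t\<bar>"
        by (rule filterlim_real_sequentially[unfolded filterlim_at_top, rule_format])
      then show "\<forall>\<^sub>F n in sequentially. ennreal ((cmod (indicator (A n) t * \<phi> t - \<phi> t))\<^sup>2) = 0"
      proof eventually_elim
        case (elim n)
        then have "t \<in> {- real n..real n}" by auto
        with A[of n] have "t \<in> A n" by blast
        then show ?case by simp
      qed
    qed
  qed (auto simp: indicator_def)
  then show ?thesis by (simp add: L2_dist_sq_def)
qed

text \<open>For a window cut to a bounded set, Parseval is Fubini's theorem. The spectral side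
  converges to \<open>c\<close> whatever the truncating sets are, and the truncation criterion makes
  the time integral converge absolutely to the same value.\<close>

lemma stft_band_limited:
  fixes F :: "real \<Rightarrow> complex" and \<phi> :: "real \<Rightarrow> real" and f :: "real \<Rightarrow> complex"
  assumes \<phi>: "square_integrable (\<lambda>t. complex_of_real (\<phi> t))"
    and G: "is_fourier_L2 (\<lambda>t. complex_of_real (\<phi> t)) G"
    and F [measurable]: "F \<in> borel_measurable borel" and F2: "integrable lborel (\<lambda>\<xi>. (cmod (F \<xi>))\<^sup>2)"
    and FL1: "integrable lborel F"
    and f: "\<And>t. f t = (LINT \<xi>|lborel. F \<xi> * cis (2 * pi * t * \<xi>))" and f_real: "\<And>t. f t \<in> \<real>"
  shows "integrable lborel (\<lambda>\<xi>. F \<xi> * cnj (G \<xi>))"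
    and "stft (\<lambda>t. complex_of_real (\<phi> t)) f x 0 = (LINT \<xi>|lborel. F \<xi> * cnj (G \<xi>) * cis (2 * pi * x * \<xi>))"
    and "stft (\<lambda>t. complex_of_real (\<phi> t)) f x 0 \<in> \<real>"
proof -
  have cis_borel [measurable]: "cis \<in> borel_measurable borel"
    by (intro borel_measurable_continuous_onI continuous_intros)
  have cnj_borel [measurable]: "cnj \<in> borel_measurable borel"
    by (intro borel_measurable_continuous_onI continuous_intros)
  have [measurable]: "\<phi> \<in> borel_measurable borel"
  proof -
    have "(\<lambda>t. complex_of_real (\<phi> t)) \<in> borel_measurable borel"
      using \<phi> by (simp add: square_integrable_def)
    then have "(\<lambda>t. Re (complex_of_real (\<phi> t))) \<in> borel_measurable borel"
      by measurable
    then show ?thesis by simp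
  qed
  have [measurable]: "G \<in> borel_measurable borel" using G by (simp add: is_fourier_L2_def)
  have f_meas [measurable]: "f \<in> borel_measurable borel"
    unfolding f[abs_def] by measurable
  have f_bd: "norm (f t) \<le> (LINT \<xi>|lborel. norm (F \<xi>))" for t
  proof -
    have "norm (f t) \<le> (LINT \<xi>|lborel. norm (F \<xi> * cis (2 * pi * t * \<xi>)))"
      unfolding f by (rule integral_norm_bound)
    then show ?thesis by (simp add: norm_mult)
  qed
  \<comment> \<open>This is the integrand of \<open>stft\<close> at frequency 0, shifted by
    \<open>x\<close>. As \<open>f\<close> is real on the line, the real part loses nothing and
    yields the real function that the truncation criterion asks for.\<close>
  define k where "k t = Re (f (t + x)) * \<phi> t" for t
  have k_eq: "complex_of_real (k t) = f (t + x) * of_real (\<phi> t)" for t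
    using f_real[of "t + x"] by (simp add: k_def)
  have k_meas [measurable]: "k \<in> borel_measurable borel"
    unfolding k_def[abs_def] by measurable
  define h where "h A t = indicator A t * \<phi> t" for A t
  have h2: "integrable lborel (\<lambda>t. (cmod (of_real (h A t)))\<^sup>2)" if [measurable]: "A \<in> sets borel" for A
  proof (rule Bochner_Integration.integrable_bound)
    show "integrable lborel (\<lambda>t. (cmod (of_real (\<phi> t)))\<^sup>2)"
      using \<phi> unfolding square_integrable_def by blast
    show "(\<lambda>t. (cmod (of_real (h A t)))\<^sup>2) \<in> borel_measurable lborel" unfolding h_def by measurable
  qed (auto simp: h_def indicator_def)
  have h_meas [measurable]: "h A \<in> borel_measurable borel" if [measurable]: "A \<in> sets borel" for A
    unfolding h_def[abs_def] by measurable
  have h1: "integrable lborel (\<lambda>t. complex_of_real (h A t))" if [measurable]: "A \<in> sets borel" and "bounded A" for A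
    by (rule integrable_if_square_integrable_bounded_support[OF _ h2, of A A]) (use that in \<open>auto simp: h_def indicator_def\<close>)
  have loc: "integrable lborel (\<lambda>t. indicator A t * k t)" if A [measurable]: "A \<in> sets borel" and "bounded A" for A
  proof (rule Bochner_Integration.integrable_bound)
    show "integrable lborel (\<lambda>t. (LINT \<xi>|lborel. norm (F \<xi>)) * norm (complex_of_real (h A t)))"
      by (intro integrable_mult_right integrable_norm h1 that)
    have "norm (indicator A t * k t) \<le> (LINT \<xi>|lborel. norm (F \<xi>)) * norm (complex_of_real (h A t))" for t
    proof -
      have "norm (indicator A t * k t) = \<bar>Re (f (t + x))\<bar> * norm (complex_of_real (h A t))"
        by (simp add: k_def h_def abs_mult norm_mult mult_ac)
      also have "\<dots> \<le> (LINT \<xi>|lborel. norm (F \<xi>)) * norm (complex_of_real (h A t))"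
        by (intro mult_right_mono order_trans[OF abs_Re_le_cmod f_bd] norm_ge_zero)
      finally show ?thesis .
    qed
    then show "AE t in lborel. norm (indicator A t * k t) \<le> norm ((LINT \<xi>|lborel. norm (F \<xi>)) * norm (complex_of_real (h A t)))"
      by (intro AE_I2) (metis abs_ge_self order_trans real_norm_def)
  qed measurable
  \<comment> \<open>The shift of \<open>f\<close> by \<open>x\<close> is a modulation of its
    spectrum, which preserves absolute values.\<close>
  define Fx where "Fx \<xi> = F \<xi> * cis (2 * pi * x * \<xi>)" for \<xi>
  define g where "g A \<xi> = cnj (fourier_L1 (\<lambda>t. complex_of_real (h A t)) \<xi>)" for A \<xi>
  have trunc: "integrable lborel (\<lambda>\<xi>. Fx \<xi> * g A \<xi>)"
    "complex_of_real (LINT t|lborel. indicator A t * k t) = (LINT \<xi>|lborel. Fx \<xi> * g A \<xi>)"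
    if A [measurable]: "A \<in> sets borel" and "bounded A" for A
  proof -
    \<comment> \<open>Integrating over \<xi> gives \<open>f (t + x) * h A t\<close>; integrating
      over \<open>t\<close> gives \<open>Fx \<xi> * g A \<xi>\<close>.\<close>
    define Q where "Q t \<xi> = F \<xi> * cis (2 * pi * (t + x) * \<xi>) * complex_of_real (h A t)" for t \<xi>
    have Q_meas: "case_prod Q \<in> borel_measurable (lborel \<Otimes>\<^sub>M lborel)"
      unfolding Q_def by measurable
    have Q: "integrable (lborel \<Otimes>\<^sub>M lborel) (case_prod Q)"
    proof (rule lborel_pair.Fubini_integrable[OF Q_meas])
      show "integrable lborel (\<lambda>t. LINT \<xi>|lborel. norm (case_prod Q (t, \<xi>)))"
        using integrable_norm[OF h1[OF that]] unfolding Q_def prod.case norm_mult norm_cis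
        by (simp del: norm_of_real)
      show "AE t in lborel. integrable lborel (\<lambda>\<xi>. case_prod Q (t, \<xi>))"
        unfolding Q_def prod.case by (intro AE_I2 integrable_mult_left integrable_mult_cis FL1) measurable
    qed
    have inner: "(LINT t|lborel. Q t \<xi>) = Fx \<xi> * g A \<xi>" for \<xi>
    proof -
      have "Q t \<xi> = Fx \<xi> * (complex_of_real (h A t) * cis (2 * pi * t * \<xi>))" for t
        by (simp add: Q_def Fx_def distrib_left distrib_right mult_ac flip: cis_mult)
      then show ?thesis
        by (simp add: g_def cnj_fourier_L1_of_real)
    qed
    show "integrable lborel (\<lambda>\<xi>. Fx \<xi> * g A \<xi>)"
      using lborel_pair.integrable_snd[OF Q] by (simp add: inner)
    have "complex_of_real (LINT t|lborel. indicator A t * k t) = (LINT t|lborel. LINT \<xi>|lborel. Q t \<xi>)"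
      unfolding integral_complex_of_real[symmetric]
    proof (intro Bochner_Integration.integral_cong refl)
      fix t
      have "complex_of_real (indicator A t * k t) = f (t + x) * of_real (h A t)"
        by (simp add: k_eq h_def indicator_def)
      then show "complex_of_real (indicator A t * k t) = (LINT \<xi>|lborel. Q t \<xi>)"
        by (simp add: Q_def f)
    qed
    also have "\<dots> = (LINT \<xi>|lborel. Fx \<xi> * g A \<xi>)"
      using lborel_pair.Fubini_integral[OF Q] by (simp add: inner)
    finally show "complex_of_real (LINT t|lborel. indicator A t * k t) = (LINT \<xi>|lborel. Fx \<xi> * g A \<xi>)" .
  qed
  define c where "c = (LINT \<xi>|lborel. Fx \<xi> * cnj (G \<xi>))"
  have Fx: "Fx \<in> borel_measurable lborel" "integrable lborel (\<lambda>\<xi>. (cmod (Fx \<xi>))\<^sup>2)"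
    using F2 unfolding Fx_def by (measurable, simp add: norm_mult)
  \<comment> \<open>The definition of \<open>G\<close> covers every approximating sequence, so the
    limit \<open>c\<close> is the same for all choices of \<open>A\<close>.\<close>
  have weak: "integrable lborel (\<lambda>\<xi>. Fx \<xi> * cnj (G \<xi>))"
    "(\<lambda>n. complex_of_real (LINT t|lborel. indicator (A n) t * k t)) \<longlonglongrightarrow> c"
    if A: "\<And>n::nat. A n \<in> sets borel" "\<And>n. bounded (A n)" "\<And>n. {- real n..real n} \<subseteq> A n" for A
  proof -
    have "square_integrable (\<lambda>t. complex_of_real (h (A n) t))" for n
      unfolding square_integrable_def using h2[OF A(1)] h_meas[OF A(1)] by simp
    moreover have "(\<lambda>n. L2_dist_sq (\<lambda>t. complex_of_real (h (A n) t)) (\<lambda>t. complex_of_real (\<phi> t))) \<longlonglongrightarrow> 0"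
    proof -
      have "(\<lambda>t. complex_of_real (h (A n) t)) = (\<lambda>t. indicator (A n) t * complex_of_real (\<phi> t))" for n
        by (auto simp: h_def indicator_def)
      then show ?thesis
        using L2_dist_sq_truncation_tendsto_0[OF \<phi> A(1,3)] by simp
    qed
    ultimately have "(\<lambda>n. L2_dist_sq (fourier_L1 (\<lambda>t. complex_of_real (h (A n) t))) G) \<longlonglongrightarrow> 0"
      using G[unfolded is_fourier_L2_def, THEN conjunct2, rule_format, of "\<lambda>n t. complex_of_real (h (A n) t)"]
        h1[OF A(1,2)] by blast
    then have L: "(\<lambda>n. L2_dist_sq (g (A n)) (\<lambda>\<xi>. cnj (G \<xi>))) \<longlonglongrightarrow> 0"
      by (simp add: L2_dist_sq_def g_def flip: complex_cnj_diff)
    have g_meas: "g (A n) \<in> borel_measurable lborel" for n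
      unfolding g_def[abs_def]
      by (simp, rule measurable_compose[OF fourier_L1_measurable[OF measurable_compose[OF h_meas[OF A(1)] borel_measurable_of_real]] cnj_borel])
    have G_meas: "(\<lambda>\<xi>. cnj (G \<xi>)) \<in> borel_measurable lborel" by measurable
    note w = L2_tendsto_weak[OF Fx G_meas g_meas trunc(1)[OF A(1,2)] L]
    show "integrable lborel (\<lambda>\<xi>. Fx \<xi> * cnj (G \<xi>))" by (rule w)
    show "(\<lambda>n. complex_of_real (LINT t|lborel. indicator (A n) t * k t)) \<longlonglongrightarrow> c"
      using w(2) by (simp add: trunc(2)[OF A(1,2)] c_def)
  qed
  have k: "has_bochner_integral lborel k (Re c)"
  proof (rule has_bochner_integral_if_truncations_converge[OF k_meas loc])
    show "(\<lambda>n. LINT t|lborel. indicator (A n) t * k t) \<longlonglongrightarrow> Re c"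
      if "\<And>n::nat. A n \<in> sets borel" "\<And>n. bounded (A n)" "\<And>n. {- real n..real n} \<subseteq> A n" for A
      using tendsto_Re[OF weak(2)[OF that]] by simp
  qed
  \<comment> \<open>\<open>c\<close> is a limit of real numbers, and the reals are closed.\<close>
  have c_real: "c = complex_of_real (Re c)"
  proof -
    have "c \<in> \<real>"
      by (rule Lim_in_closed_set[OF closed_complex_Reals _ _ weak(2)[of "\<lambda>n. {- real n..real n}"]]) auto
    then show ?thesis by simp
  qed
  have "stft (\<lambda>t. complex_of_real (\<phi> t)) f x 0 = (LINT t|lborel. f t * of_real (\<phi> (t - x)))"
    by (simp add: stft_def)
  also have "\<dots> = (LINT t|lborel. complex_of_real (k t))"
    by (subst lborel_integral_real_affine[of 1 _ x]) (simp_all add: k_eq add.commute)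
  also have "\<dots> = c"
    using has_bochner_integral_integral_eq[OF k] c_real by simp
  finally have stft: "stft (\<lambda>t. complex_of_real (\<phi> t)) f x 0 = c" .
  show "stft (\<lambda>t. complex_of_real (\<phi> t)) f x 0 = (LINT \<xi>|lborel. F \<xi> * cnj (G \<xi>) * cis (2 * pi * x * \<xi>))"
    unfolding stft c_def Fx_def by (simp add: mult_ac)
  show "stft (\<lambda>t. complex_of_real (\<phi> t)) f x 0 \<in> \<real>"
    unfolding stft by (subst c_real) simp
  \<comment> \<open>The opposite modulation undoes the shift by \<open>x\<close>.\<close>
  have "integrable lborel (\<lambda>\<xi>. Fx \<xi> * cnj (G \<xi>) * cis (- (2 * pi * x * \<xi>)))"
    by (intro integrable_mult_cis weak(1)[of "\<lambda>n. {- real n..real n}"]) auto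
  moreover have "Fx \<xi> * cnj (G \<xi>) * cis (- (2 * pi * x * \<xi>)) = F \<xi> * cnj (G \<xi>)" for \<xi>
    by (simp add: Fx_def mult_ac flip: cis_inverse)
  ultimately show "integrable lborel (\<lambda>\<xi>. F \<xi> * cnj (G \<xi>))" by simp
qed

section \<open>Phase retrieval from samples\<close>

text \<open>Outside the band \<open>D\<close> is 0 by its support; inside, the nonzero factor
  \<open>cnj (G \<xi>)\<close> cancels.\<close>

lemma AE_eq_0_if_mult_cnj_AE_0:
  fixes D G :: "real \<Rightarrow> complex"
  assumes "AE \<xi> in lborel. D \<xi> * cnj (G \<xi>) = 0" and "AE \<xi> in lborel. \<xi> \<in> {-B<..<B} \<longrightarrow> G \<xi> \<noteq> 0"
    and supp: "\<And>\<xi>. D \<xi> \<noteq> 0 \<Longrightarrow> \<bar>\<xi>\<bar> < B"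
  shows "AE \<xi> in lborel. D \<xi> = 0"
  using assms(1,2) by eventually_elim (use supp in \<open>fastforce simp: abs_less_iff\<close>)

theorem theorem2p3:
  fixes B :: real and \<phi> :: "real \<Rightarrow> real" and f g :: "complex \<Rightarrow> complex"
  assumes "B > 0"
    and "square_integrable (\<lambda>t. complex_of_real (\<phi> t))"
    and "\<exists>G. is_fourier_L2 (\<lambda>t. complex_of_real (\<phi> t)) G \<and>
              (AE \<xi> in lborel. \<xi> \<in> {-B<..<B} \<longrightarrow> G \<xi> \<noteq> 0)"
    and "f \<in> PW B" and "g \<in> PW B"
    and "\<forall>x::real. f (complex_of_real x) \<in> \<real>"
    and "\<forall>x::real. g (complex_of_real x) \<in> \<real>"
  shows "(f = g \<or> f = (\<lambda>z. - g z)) \<longleftrightarrow>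
    (\<forall>n::int.
       cmod (stft (\<lambda>t. complex_of_real (\<phi> t)) (\<lambda>t. f (complex_of_real t)) (real_of_int n / (4 * B)) 0)
     = cmod (stft (\<lambda>t. complex_of_real (\<phi> t)) (\<lambda>t. g (complex_of_real t)) (real_of_int n / (4 * B)) 0))"
    (is "?eq \<longleftrightarrow> ?samples")
proof
  assume ?eq
  then show ?samples by (auto simp: stft_def)
next
  assume samples: ?samples
  obtain G where G: "is_fourier_L2 (\<lambda>t. complex_of_real (\<phi> t)) G"
    "AE \<xi> in lborel. \<xi> \<in> {-B<..<B} \<longrightarrow> G \<xi> \<noteq> 0"
    using assms(3) by blast
  obtain F\<^sub>f where Ff: "F\<^sub>f \<in> borel_measurable borel" "\<And>\<xi>. F\<^sub>f \<xi> \<noteq> 0 \<Longrightarrow> \<bar>\<xi>\<bar> < B"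
    "integrable lborel (\<lambda>\<xi>. (cmod (F\<^sub>f \<xi>))\<^sup>2)"
    "\<And>z. f z = (LINT \<xi>|lborel. F\<^sub>f \<xi> * exp (2 * of_real pi * \<i> * of_real \<xi> * z))"
    by (rule PW_representation[OF \<open>f \<in> PW B\<close>]) blast
  obtain F\<^sub>g where Fg: "F\<^sub>g \<in> borel_measurable borel" "\<And>\<xi>. F\<^sub>g \<xi> \<noteq> 0 \<Longrightarrow> \<bar>\<xi>\<bar> < B"
    "integrable lborel (\<lambda>\<xi>. (cmod (F\<^sub>g \<xi>))\<^sup>2)"
    "\<And>z. g z = (LINT \<xi>|lborel. F\<^sub>g \<xi> * exp (2 * of_real pi * \<i> * of_real \<xi> * z))"
    by (rule PW_representation[OF \<open>g \<in> PW B\<close>]) blast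
  have exp_cis: "exp (2 * complex_of_real pi * \<i> * of_real \<xi> * of_real t) = cis (2 * pi * t * \<xi>)" for \<xi> t
    by (simp add: cis_conv_exp mult_ac)
  have f_real: "f (of_real t) = (LINT \<xi>|lborel. F\<^sub>f \<xi> * cis (2 * pi * t * \<xi>))"
    and g_real: "g (of_real t) = (LINT \<xi>|lborel. F\<^sub>g \<xi> * cis (2 * pi * t * \<xi>))" for t
    by (simp_all only: Ff(4) Fg(4) exp_cis)
  have int_Ff: "integrable lborel F\<^sub>f"
    by (rule integrable_if_square_integrable_bounded_support[OF Ff(1,3), of "{-B<..<B}"]) (use Ff(2) in force)+
  note Sf = stft_band_limited[where f = "\<lambda>t. f (complex_of_real t)", OF assms(2) G(1) Ff(1,3) int_Ff f_real assms(6)[rule_format]]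
  have int_Fg: "integrable lborel F\<^sub>g"
    by (rule integrable_if_square_integrable_bounded_support[OF Fg(1,3), of "{-B<..<B}"]) (use Fg(2) in force)+
  note Sg = stft_band_limited[where f = "\<lambda>t. g (complex_of_real t)", OF assms(2) G(1) Fg(1,3) int_Fg g_real assms(7)[rule_format]]
  \<comment> \<open>By the Parseval formula, \<open>H\<^sub>1\<close> and \<open>H\<^sub>2\<close>
    are the spectra, in the position variable, of the difference and the sum of the two transforms
    at frequency 0.\<close>
  define H\<^sub>1 where "H\<^sub>1 \<xi> = (F\<^sub>f \<xi> - F\<^sub>g \<xi>) * cnj (G \<xi>)" for \<xi>
  define H\<^sub>2 where "H\<^sub>2 \<xi> = (F\<^sub>f \<xi> + F\<^sub>g \<xi>) * cnj (G \<xi>)" for \<xi>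
  have supp: "\<bar>\<xi>\<bar> < B" if "F\<^sub>f \<xi> - F\<^sub>g \<xi> \<noteq> 0 \<or> F\<^sub>f \<xi> + F\<^sub>g \<xi> \<noteq> 0" for \<xi>
    using that Ff(2)[of \<xi>] Fg(2)[of \<xi>] by (cases "F\<^sub>f \<xi> = 0") auto
  have "(AE \<xi> in lborel. H\<^sub>1 \<xi> = 0) \<or> (AE \<xi> in lborel. H\<^sub>2 \<xi> = 0)"
  proof (rule AE_eq_0_if_samples_product_0[OF _ _ _ _ \<open>B > 0\<close>])
    show "integrable lborel H\<^sub>1" "integrable lborel H\<^sub>2"
      unfolding H\<^sub>1_def[abs_def] H\<^sub>2_def[abs_def] using Sf(1) Sg(1) by (simp_all add: left_diff_distrib distrib_right)
    show "\<bar>\<xi>\<bar> < B" if "H\<^sub>1 \<xi> \<noteq> 0" for \<xi>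
      using that supp[of \<xi>] unfolding H\<^sub>1_def by force
    show "\<bar>\<xi>\<bar> < B" if "H\<^sub>2 \<xi> \<noteq> 0" for \<xi>
      using that supp[of \<xi>] unfolding H\<^sub>2_def by force
    fix n :: int
    define x where "x = real_of_int n / (4 * B)"
    let ?Sf = "stft (\<lambda>t. complex_of_real (\<phi> t)) (\<lambda>t. f (complex_of_real t)) x 0"
    let ?Sg = "stft (\<lambda>t. complex_of_real (\<phi> t)) (\<lambda>t. g (complex_of_real t)) x 0"
    have int: "integrable lborel (\<lambda>\<xi>. F\<^sub>f \<xi> * cnj (G \<xi>) * cis (2 * pi * x * \<xi>))"
      "integrable lborel (\<lambda>\<xi>. F\<^sub>g \<xi> * cnj (G \<xi>) * cis (2 * pi * x * \<xi>))"
      by (intro integrable_mult_cis Sf(1) Sg(1); measurable)+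
    have "(LINT \<xi>|lborel. H\<^sub>1 \<xi> * cis (2 * pi * x * \<xi>)) = ?Sf - ?Sg"
      "(LINT \<xi>|lborel. H\<^sub>2 \<xi> * cis (2 * pi * x * \<xi>)) = ?Sf + ?Sg"
      unfolding Sf(2) Sg(2) H\<^sub>1_def H\<^sub>2_def using int by (simp_all add: left_diff_distrib distrib_right)
    \<comment> \<open>Both values are real, so equal moduli mean that they agree up to sign.\<close>
    moreover have "(?Sf - ?Sg) * (?Sf + ?Sg) = 0"
    proof -
      have "cmod ?Sf = cmod ?Sg" using samples by (simp add: x_def)
      then show ?thesis
        using Sf(3)[of x] Sg(3)[of x] by (auto elim!: Reals_cases simp: abs_eq_iff)
    qed
    ultimately show "(LINT \<xi>|lborel. H\<^sub>1 \<xi> * cis (2 * pi * (of_int n / (4 * B)) * \<xi>)) *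
        (LINT \<xi>|lborel. H\<^sub>2 \<xi> * cis (2 * pi * (of_int n / (4 * B)) * \<xi>)) = 0"
      by (simp only: x_def)
  qed
  then show ?eq
  proof
    assume "AE \<xi> in lborel. H\<^sub>1 \<xi> = 0"
    then have "AE \<xi> in lborel. F\<^sub>f \<xi> - F\<^sub>g \<xi> = 0"
      unfolding H\<^sub>1_def using G(2) supp by (rule AE_eq_0_if_mult_cnj_AE_0) blast
    \<comment> \<open>Spectra that agree almost everywhere give the same integral at every complex
      \<open>z\<close>, so the equality holds beyond the real line.\<close>
    then have "f z = g z" for z
      unfolding Ff(4) Fg(4) using Ff(1) Fg(1) by (intro integral_cong_AE) auto
    then show ?eq by blast
  next
    assume "AE \<xi> in lborel. H\<^sub>2 \<xi> = 0"
    then have "AE \<xi> in lborel. F\<^sub>f \<xi> + F\<^sub>g \<xi> = 0"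
      unfolding H\<^sub>2_def using G(2) supp by (rule AE_eq_0_if_mult_cnj_AE_0) blast
    then have "f z = - g z" for z
      unfolding Ff(4) Fg(4) Bochner_Integration.integral_minus[symmetric] using Ff(1) Fg(1)
      by (intro integral_cong_AE) (auto simp: eq_neg_iff_add_eq_0 simp flip: distrib_right)
    then show ?eq by blast
  qed
qed

end
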